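(* Let $d\ge 2$ and $\alpha\in(0,1)$, and let $(Z(t))_{t\ge 0}$ be the orthogonal continuous-time conservative walk (Model A) on $\mathbb{R}^d$ generated by the rate function $\lambda(t)=t^{-\alpha}$, $t>0$. Then $Z(t)$ is transient almost surely.
   Context: Model A (orthogonal conservative walk) on $\mathbb{R}^d$: Let $\lambda\ge 0$ be a rate function with $\Lambda(T)=\int_0^T\lambda(t)\,dt<\infty$ for all $T\ge 0$ and $\Lambda(T)\to\infty$ as $T\to\infty$. Let $\tau_0=0$ and let $\tau_1<\tau_2<\dots$ be the consecutive points of a non-homogeneous Poisson point process on $[0,\infty)$ with rate $\lambda(t)$. Let $\mathbf f_0,\mathbf f_1,\mathbf f_2,\dots$ be i.i.d. random vectors, independent of $(\tau_k)_{k\ge1}$, each uniformly distributed on the set of $2d$ unit vectors $\{\pm \mathbf e_1,\dots,\pm\mathbf e_d\}$ of $\mathbb{R}^d$. With $N(t)=\sup\{k\ge 0:\tau_k\le t\}$, the walk is $$Z(t)=\sum_{k=0}^{N(t)-1}(\tau_{k+1}-\tau_k)\mathbf f_k+(t-\tau_{N(t)})\mathbf f_{N(t)},\qquad t\ge 0.$$ Transience: for $\rho\ge 0$, $Z(t)$ is $\rho$-recurrent if there is an infinite sequence of times $t_1<t_2<\dots$ converging to infinity with $Z(t_i)\in[-\rho,\rho]^d$ for all $i$. $Z(t)$ is transient if it is not $\rho$-recurrent for any $\rho>0$, equivalently $\lim_{t\to\infty}\|Z(t)\|=\infty$. *)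

theory Defs
  imports "HOL-Probability.Probability" "HOL-Real_Asymp.Real_Asymp"
begin

definition cumulative_rate :: "(real \<Rightarrow> real) \<Rightarrow> real \<Rightarrow> real" where
  "cumulative_rate r T = (LINT t:{0..T}|lborel. r t)"

definition rate_function :: "(real \<Rightarrow> real) \<Rightarrow> bool" where
  "rate_function r \<longleftrightarrow>
     (\<forall>t\<ge>0. 0 \<le> r t) \<and>
     (\<forall>T\<ge>0. set_integrable lborel {0..T} r) \<and>
     filterlim (cumulative_rate r) at_top at_top"

text \<open>
  The points of the process are \<open>\<tau> 1, \<tau> 2, \<dots>\<close>; the value \<open>\<tau> 0\<close> is the starting
  time of the walk and is not a point of the process.
\<close>

definition point_count :: "(nat \<Rightarrow> 'a \<Rightarrow> real) \<Rightarrow> real set \<Rightarrow> 'a \<Rightarrow> nat" where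
  "point_count \<tau> B \<omega> = card {k. 1 \<le> k \<and> \<tau> k \<omega> \<in> B}"

text \<open>
  Since \<open>card\<close> of an infinite set is \<open>0\<close>, the counts are meaningful only together with
  local finiteness, which is a separate clause below. The sets \<open>B\<close> range over the bounded
  Borel subsets of the half-line, so that their intensity is finite; it may be \<open>0\<close>, in which
  case the Poisson probabilities below are those of the constant \<open>0\<close> (because \<open>0 ^ 0 = 1\<close>).
\<close>

locale poisson_points = prob_space M
  for M :: "'a measure" and r :: "real \<Rightarrow> real" and \<tau> :: "nat \<Rightarrow> 'a \<Rightarrow> real" +
  assumes rate: "rate_function r"
    and points_measurable [measurable]: "\<And>k. \<tau> k \<in> borel_measurable M"
    and points_ordered: "AE \<omega> in M. 0 \<le> \<tau> 1 \<omega> \<and> strict_mono_on {1..} (\<lambda>k. \<tau> k \<omega>)"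
    and points_locally_finite: "AE \<omega> in M. \<forall>T. finite {k. 1 \<le> k \<and> \<tau> k \<omega> \<le> T}"
    and counts_poisson:
      "\<And>B n. B \<in> sets borel \<Longrightarrow> bounded B \<Longrightarrow> B \<subseteq> {0..} \<Longrightarrow>
         prob {\<omega> \<in> space M. point_count \<tau> B \<omega> = n} =
           exp (- (LINT t:B|lborel. r t)) * (LINT t:B|lborel. r t) ^ n / fact n"
    and counts_indep:
      "\<And>(B :: nat \<Rightarrow> real set) m.
         (\<And>i. i < m \<Longrightarrow> B i \<in> sets borel \<and> bounded (B i) \<and> B i \<subseteq> {0..}) \<Longrightarrow>
         disjoint_family_on B {..<m} \<Longrightarrow>
         indep_vars (\<lambda>_. count_space UNIV) (\<lambda>i. point_count \<tau> (B i)) {..<m}"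

definition signed_unit_vectors :: "(real ^ 'd) set" where
  "signed_unit_vectors = range (\<lambda>i. axis i 1) \<union> range (\<lambda>i. - axis i 1)"

text \<open>
  The law of a direction is the uniform distribution on the signed unit vectors, transported
  from the discrete to the Borel sigma-algebra. The two sequences have different value types,
  so their independence is stated for the sigma-algebras they generate.
\<close>

locale orthogonal_walk = poisson_points M r \<tau>
  for M :: "'a measure" and r :: "real \<Rightarrow> real" and \<tau> :: "nat \<Rightarrow> 'a \<Rightarrow> real" +
  fixes f :: "nat \<Rightarrow> 'a \<Rightarrow> real ^ 'd"
  assumes start_time: "\<And>\<omega>. \<omega> \<in> space M \<Longrightarrow> \<tau> 0 \<omega> = 0"
    and directions_uniform:
      "\<And>k. distr M borel (f k) = distr (measure_pmf (pmf_of_set signed_unit_vectors)) borel (\<lambda>x. x)"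
    and directions_indep: "indep_vars (\<lambda>_. borel) f UNIV"
    and directions_indep_points:
      "indep_set
         (sets (vimage_algebra (space M) (\<lambda>\<omega> k. \<tau> k \<omega>) (\<Pi>\<^sub>M k\<in>UNIV. borel)))
         (sets (vimage_algebra (space M) (\<lambda>\<omega> k. f k \<omega>) (\<Pi>\<^sub>M k\<in>UNIV. borel)))"

definition jump_index :: "(nat \<Rightarrow> real) \<Rightarrow> real \<Rightarrow> nat" where
  "jump_index s t = Sup {k. s k \<le> t}"

definition walk :: "(nat \<Rightarrow> real) \<Rightarrow> (nat \<Rightarrow> real ^ 'd) \<Rightarrow> real \<Rightarrow> real ^ 'd" where
  "walk s v t =
     (\<Sum>k<jump_index s t. (s (Suc k) - s k) *\<^sub>R v k)
     + (t - s (jump_index s t)) *\<^sub>R v (jump_index s t)"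

definition recurrent_path :: "real \<Rightarrow> (real \<Rightarrow> real ^ 'd) \<Rightarrow> bool" where
  "recurrent_path \<rho> z \<longleftrightarrow>
     (\<exists>u :: nat \<Rightarrow> real. (\<forall>i. 0 \<le> u i) \<and> strict_mono u \<and> filterlim u at_top sequentially \<and>
        (\<forall>i. \<forall>j. z (u i) $ j \<in> {-\<rho>..\<rho>}))"

definition transient_path :: "(real \<Rightarrow> real ^ 'd) \<Rightarrow> bool" where
  "transient_path z \<longleftrightarrow> (\<forall>\<rho>>0. \<not> recurrent_path \<rho> z)"

lemma set_integral_powr_minus:
  fixes a T :: real
  assumes a: "0 < a" "a < 1" and T: "0 \<le> T"
  shows "set_integrable lborel {0..T} (\<lambda>t. t powr - a)"
    and "cumulative_rate (\<lambda>t. t powr - a) T = T powr (1 - a) / (1 - a)"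
proof -
  have hk: "((\<lambda>t. t powr - a) has_integral T powr (1 - a) / (1 - a)) {0..T}"
    using has_integral_powr_from_0[of "- a" T] a T by (simp add: add.commute)
  have "(\<lambda>t. t powr - a) absolutely_integrable_on {0..T}"
    by (rule nonnegative_absolutely_integrable_1) (use hk in auto)
  then have *: "set_integrable lborel {0..T} (\<lambda>t. t powr - a)"
    unfolding set_integrable_def by (subst (asm) integrable_completion) auto
  then show "set_integrable lborel {0..T} (\<lambda>t. t powr - a)" .
  show "cumulative_rate (\<lambda>t. t powr - a) T = T powr (1 - a) / (1 - a)"
    using set_borel_integral_eq_integral(2)[OF *] hk
    unfolding cumulative_rate_def by (simp add: integral_unique)
qed

lemma rate_function_powr_minus:
  fixes a :: real
  assumes a: "0 < a" "a < 1"
  shows "rate_function (\<lambda>t. t powr - a)"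
proof -
  have "filterlim (\<lambda>T. T powr (1 - a) / (1 - a)) at_top at_top"
    using a by real_asymp
  moreover have "\<forall>\<^sub>F T in at_top. T powr (1 - a) / (1 - a) = cumulative_rate (\<lambda>t. t powr - a) T"
    using eventually_ge_at_top[of "0::real"]
    by eventually_elim (use set_integral_powr_minus(2)[OF a] in simp)
  ultimately have "filterlim (cumulative_rate (\<lambda>t. t powr - a)) at_top at_top"
    by (simp add: filterlim_cong[OF refl refl])
  then show ?thesis
    unfolding rate_function_def using set_integral_powr_minus(1)[OF a] by auto
qed

lemma transient_path_iff_filterlim_norm:
  fixes z :: "real \<Rightarrow> real ^ 'd"
  shows "transient_path z \<longleftrightarrow> filterlim (\<lambda>t. norm (z t)) at_top at_top"
proof
  assume tr: "transient_path z"
  show "filterlim (\<lambda>t. norm (z t)) at_top at_top"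
  proof (rule ccontr)
    assume "\<not> filterlim (\<lambda>t. norm (z t)) at_top at_top"
    then obtain r where r: "\<not> (\<forall>\<^sub>F t in at_top. r \<le> norm (z t))"
      unfolding filterlim_at_top by auto
    have ex: "\<exists>t\<ge>x. norm (z t) \<le> max r 1" for x
      using r unfolding eventually_at_top_linorder by (meson le_max_iff_disj linear)
    define g where "g x = (SOME t. t \<ge> x \<and> norm (z t) \<le> max r 1)" for x
    have g: "g x \<ge> x \<and> norm (z (g x)) \<le> max r 1" for x
      unfolding g_def using someI_ex[OF ex[of x]] by auto
    define u where "u = rec_nat (g 0) (\<lambda>_ x. g (x + 1))"
    have u0: "u 0 = g 0" and uS: "u (Suc n) = g (u n + 1)" for n
      by (simp_all add: u_def)
    have step: "u (Suc n) \<ge> u n + 1" for n using uS g by metis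
    have ge: "u n \<ge> real n" for n
    proof (induction n)
      case 0 then show ?case using u0 g[of 0] by simp
    next
      case (Suc n) then show ?case using step[of n] by simp
    qed
    have near: "norm (z (u n)) \<le> max r 1" for n
      by (cases n) (use u0 uS g in auto)
    have "recurrent_path (max r 1) z"
      unfolding recurrent_path_def
    proof (intro exI[of _ u] conjI allI)
      show "0 \<le> u i" for i using ge[of i] by linarith
      show "strict_mono u"
        unfolding strict_mono_Suc_iff using step by (smt (verit))
      show "filterlim u at_top sequentially"
        by (rule filterlim_at_top_mono[OF filterlim_real_sequentially]) (use ge in auto)
      show "z (u i) $ j \<in> {- max r 1..max r 1}" for i j
        using component_le_norm_cart[of "z (u i)" j] near[of i] by (auto simp: abs_le_iff)
    qed
    moreover have "max r 1 > 0" by simp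
    ultimately show False using tr unfolding transient_path_def by blast
  qed
next
  assume lim: "filterlim (\<lambda>t. norm (z t)) at_top at_top"
  show "transient_path z"
    unfolding transient_path_def recurrent_path_def
  proof (intro allI impI notI, elim exE conjE)
    fix \<rho> :: real and u :: "nat \<Rightarrow> real"
    assume u: "filterlim u at_top sequentially" "\<forall>i j. z (u i) $ j \<in> {-\<rho>..\<rho>}"
    have "norm (z (u i)) \<le> (\<Sum>j\<in>(UNIV :: 'd set). \<rho>)" for i
      by (rule order_trans[OF norm_le_l1_cart sum_mono]) (use u(2) in \<open>auto simp: abs_le_iff\<close>, smt (verit))
    moreover have "\<forall>\<^sub>F i in sequentially. norm (z (u i)) \<ge> (\<Sum>j\<in>(UNIV :: 'd set). \<rho>) + 1"
      using filterlim_compose[OF lim u(1)] unfolding filterlim_at_top by blast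
    ultimately show False
      by (smt (verit) eventually_sequentially order_refl)
  qed
qed

end

theory Submission
  imports Defs
begin

text \<open>
  The walk moves at unit speed, so a visit to a bounded box at a large time forces it to lie in a
  slightly larger box at the preceding integer time. By the Borel--Cantelli lemma it therefore
  suffices to show that the probabilities that two fixed coordinates of \<open>Z(n)\<close> are both bounded
  by a constant are summable over the integers \<open>n\<close>. The expected order of this probability is
  \<open>n powr (- 1 - \<alpha>)\<close>: by time \<open>n\<close> the walk has made about \<open>n powr (1 - \<alpha>)\<close> steps of length about
  \<open>n powr \<alpha>\<close>, so each coordinate is spread over a scale \<open>n powr ((1 + \<alpha>) / 2)\<close>.

  The spread comes from the randomness of certain jump times. Cut \<open>[0, n)\<close> into about
  \<open>n powr (1 - \<alpha>)\<close> windows of length about \<open>n powr \<alpha>\<close>, and each window into many tiny cells. A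
  window in the second half of \<open>[0, n)\<close> carries Poisson mass of order one, and the mass is nearly
  equidistributed over its cells. Its vector of cell counts is hence a mixture: with probability
  bounded below it consists of a single point in a cell chosen exactly uniformly, and otherwise it
  follows some residual law (\<open>Pi_pmf_window_mixture\<close>). Fix everything but the positions of these
  uniform points. The index of each such point in the sequence of jumps is then fixed, and moving
  the point moves the walk at time \<open>n\<close> linearly, along the difference of the directions before
  and after the jump. If these are \<open>e\<^sub>a\<close> and \<open>- e\<^sub>a\<close>, a \<^emph>\<open>reversal\<close>, then only coordinate \<open>a\<close> moves.
  With at least \<open>m\<close> reversals on each of two axes, the two coordinates become independent sums of at
  least \<open>m\<close> independent uniform variables, up to terms independent of those variables.

  A sum of \<open>m\<close> independent uniform variables on \<open>2 H\<close> consecutive integers takes each value with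
  probability at most \<open>1 / (H * sqrt m)\<close> (\<open>pmf_uniform_sum_le\<close>): one summand is kept uniform, which
  gives the factor \<open>1 / H\<close>, and every other summand contributes one fair bit, which gives
  \<open>1 / sqrt m\<close> through the central binomial coefficient. With windows of \<open>2 H\<close> cells, a
  bounded interval for a coordinate corresponds to a number of values of order \<open>H * n powr (- \<alpha>)\<close>
  for the sum. With \<open>m\<close> of order \<open>n powr (1 - \<alpha>)\<close>, the bounds for the two axes therefore multiply
  to the order \<open>n powr (- 1 - \<alpha>)\<close>. That there are this many reversals
  fails only with probability exponentially small in \<open>n powr (1 - \<alpha>)\<close>, by an exponential moment
  bound, once for the number of single-point windows and once for the number of reversals among them
  (\<open>grid_box_prob_le\<close>).
\<close>

section \<open>Concentration of sums of independent uniform variables\<close>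

lemma central_binomial_upper_bound:
  "real ((2 * n) choose n) \<le> 4 ^ n / sqrt (2 * real n + 1)"
proof (induction n)
  case (Suc n)
  define c where "c = real ((2 * n) choose n)"
  have "real ((2 * Suc n) choose Suc n) * (real n + 1) = 2 * (2 * real n + 1) * c"
  proof -
    have "Suc n * ((2 * Suc n) choose Suc n) = (2 * Suc n) * ((2 * n + 1) choose n)"
      using Suc_times_binomial_eq[of "2 * n + 1" n] by simp
    moreover have "(n + 1) * ((2 * n + 1) choose n) = (2 * n + 1) * ((2 * n) choose n)"
      using binomial_absorb_comp[of "2 * n + 1" n] by simp
    ultimately have "(n + 1) * (Suc n * ((2 * Suc n) choose Suc n)) 
        = (n + 1) * (2 * ((2 * n + 1) * ((2 * n) choose n)))"
      by (simp add: algebra_simps)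
    then have "Suc n * ((2 * Suc n) choose Suc n) = 2 * ((2 * n + 1) * ((2 * n) choose n))"
      by (metis Suc_eq_plus1 mult_cancel1 nat.distinct(1))
    then have "real (Suc n * ((2 * Suc n) choose Suc n)) = real (2 * ((2 * n + 1) * ((2 * n) choose n)))"
      by (rule arg_cong)
    then show ?thesis unfolding c_def of_nat_mult of_nat_add by (simp add: algebra_simps)
  qed
  then have eq: "real ((2 * Suc n) choose Suc n) = 2 * (2 * real n + 1) / (real n + 1) * c"
    by (simp add: field_simps)
  have "(2 * real n + 1) * sqrt (2 * real n + 3) \<le> 2 * (real n + 1) * sqrt (2 * real n + 1)"
  proof (rule power2_le_imp_le)
    have "(2 * real n + 1) * ((2 * real n + 1) * (2 * real n + 3)) \<le> (2 * real n + 1) * (4 * (real n + 1)^2)"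
      by (intro mult_left_mono) (auto simp: power2_eq_square algebra_simps)
    then show "((2 * real n + 1) * sqrt (2 * real n + 3))\<^sup>2 \<le> (2 * (real n + 1) * sqrt (2 * real n + 1))\<^sup>2"
      by (simp add: power_mult_distrib power2_eq_square algebra_simps)
  qed simp
  then have ratio: "2 * (2 * real n + 1) / (real n + 1) / sqrt (2 * real n + 1) \<le> 4 / sqrt (2 * real n + 3)"
  proof -
    have "2 * ((2 * real n + 1) * sqrt (2 * real n + 3)) \<le> 4 * ((real n + 1) * sqrt (2 * real n + 1))"
      using \<open>_ \<le> 2 * (real n + 1) * sqrt (2 * real n + 1)\<close> by (simp only: mult.assoc)
    then have "2 * (2 * real n + 1) * sqrt (2 * real n + 3) \<le> 4 * ((real n + 1) * sqrt (2 * real n + 1))"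
      by (simp only: mult.assoc)
    moreover have "x / y \<le> z / w" if "x * w \<le> z * y" "0 < y" "0 < w" for x y z w :: real
      using that by (simp add: field_simps)
    ultimately show ?thesis unfolding divide_divide_eq_left by simp
  qed
  have "2 * (2 * real n + 1) / (real n + 1) * c \<le> 2 * (2 * real n + 1) / (real n + 1) * (4 ^ n / sqrt (2 * real n + 1))"
    using Suc.IH unfolding c_def by (intro mult_left_mono) auto
  also have "\<dots> = 4 ^ n * (2 * (2 * real n + 1) / (real n + 1) / sqrt (2 * real n + 1))"
    by simp
  also have "\<dots> \<le> 4 ^ n * (4 / sqrt (2 * real n + 3))"
    using ratio by (intro mult_left_mono) auto
  finally show ?case unfolding eq by (simp add: algebra_simps)
qed simp

lemma symmetric_binomial_pmf_le:
  "pmf (binomial_pmf n (1/2)) k \<le> 1 / sqrt (real n + 1)"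
proof -
  have "real (n choose k) \<le> 2 ^ n / sqrt (real n + 1)"
  proof (cases "even n")
    case True
    then obtain m where n: "n = 2 * m" by auto
    have "real (n choose k) \<le> real ((2 * m) choose m)"
      using binomial_maximum'[of m k] n by simp
    also have "\<dots> \<le> 4 ^ m / sqrt (2 * real m + 1)" by (rule central_binomial_upper_bound)
    finally show ?thesis by (simp add: n power_mult)
  next
    case False
    then obtain m where n: "n = 2 * m + 1" using oddE by blast
    have "2 * (n choose k) \<le> 2 * (n choose m)"
      using binomial_maximum[of n k] n by simp
    also have "2 * (n choose m) = (2 * Suc m) choose Suc m"
      using central_binomial_odd[of n] n by (simp add: choose_reduce_nat)
    finally have "2 * real (n choose k) \<le> real ((2 * Suc m) choose Suc m)"
      by (metis of_nat_le_iff of_nat_mult of_nat_numeral)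
    also have "\<dots> \<le> 4 ^ Suc m / sqrt (2 * real (Suc m) + 1)" by (rule central_binomial_upper_bound)
    also have "\<dots> \<le> 4 ^ Suc m / sqrt (real n + 1)"
      using n by (intro divide_left_mono) auto
    finally show ?thesis by (simp add: n power_mult)
  qed
  then have "real (n choose k) / 2 ^ n \<le> 1 / sqrt (real n + 1)"
    by (simp add: field_simps)
  moreover have "pmf (binomial_pmf n (1/2)) k = real (n choose k) / 2 ^ n"
  proof (cases "k \<le> n")
    case True
    then have "(1 / 2 :: real) ^ k * (1 / 2) ^ (n - k) = (1 / 2) ^ n"
      by (simp flip: power_add)
    then show ?thesis by (simp add: power_divide mult.assoc)
  qed (simp add: binomial_eq_0)
  ultimately show ?thesis by simp
qed

lemma pmf_of_set_double_interval:
  fixes H :: nat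
  assumes "0 < H"
  shows "pmf_of_set {..<2 * H} =
    pmf_of_set {..<H} \<bind> (\<lambda>v. bernoulli_pmf (1/2) \<bind> (\<lambda>b. return_pmf (of_bool b * H + v)))"
proof -
  have "pmf_of_set {..<H} \<bind> (\<lambda>v. bernoulli_pmf (1/2) \<bind> (\<lambda>b. return_pmf (of_bool b * H + v)))
     = bernoulli_pmf (1/2) \<bind> (\<lambda>b. map_pmf (\<lambda>v. of_bool b * H + v) (pmf_of_set {..<H}))"
    unfolding map_pmf_def by (rule bind_commute_pmf)
  also have "\<dots> = bernoulli_pmf (1/2) \<bind> (\<lambda>b. pmf_of_set ((\<lambda>v. of_bool b * H + v) ` {..<H}))"
    using assms by (intro bind_pmf_cong refl map_pmf_of_set_inj) auto
  also have "\<dots> = pmf_of_set {..<2 * H}"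
  proof (rule pmf_eqI)
    fix x
    have T: "x \<in> (\<lambda>v. H + v) ` {..<H} \<longleftrightarrow> H \<le> x \<and> x < 2 * H"
      by (auto simp: image_iff intro!: bexI[of _ "x - H"])
    show "pmf (bernoulli_pmf (1/2) \<bind> (\<lambda>b. pmf_of_set ((\<lambda>v. of_bool b * H + v) ` {..<H}))) x
       = pmf (pmf_of_set {..<2 * H}) x"
      using assms T by (auto simp: pmf_bind card_image indicator_def lessThan_empty_iff)
  qed
  finally show ?thesis by simp
qed

text \<open>
  A uniform variable on \<open>2 H\<close> consecutive integers is \<open>H * b + v\<close> with a fair bit \<open>b\<close> and an
  independent \<open>v\<close> uniform on \<open>H\<close> integers. Given the \<open>v\<close> parts, the sum falls into an interval of
  length \<open>2 H\<close> for at most two values of the binomially distributed number of set bits.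
\<close>

lemma emeasure_uniform_sum_window_le:
  fixes T :: "'i set" and H :: nat
  assumes "finite T" "0 < H"
  shows "emeasure (Pi_pmf T 0 (\<lambda>_. pmf_of_set {..<2 * H})) {u. sum u T \<le> x \<and> x < sum u T + 2 * H}
    \<le> ennreal (2 / sqrt (real (card T) + 1))"
proof -
  let ?E = "{u. sum u T \<le> x \<and> x < sum u T + 2 * H}"
  let ?bern = "Pi_pmf T False (\<lambda>_. bernoulli_pmf (1/2))"
  have eq: "Pi_pmf T 0 (\<lambda>_. pmf_of_set {..<2 * H}) =
    Pi_pmf T 0 (\<lambda>_. pmf_of_set {..<H}) \<bind> (\<lambda>v. ?bern \<bind>
       (\<lambda>b. return_pmf (\<lambda>i. if i \<in> T then of_bool (b i) * H + v i else 0)))"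
    by (simp add: pmf_of_set_double_interval[OF assms(2)] Pi_pmf_bind[OF assms(1), where d' = 0]
        Pi_pmf_bind[OF assms(1), where d' = False] assms(1))
  have inner: "emeasure (bind_pmf ?bern (\<lambda>b. return_pmf (\<lambda>i. if i \<in> T then of_bool (b i) * H + v i else 0))) ?E
      \<le> ennreal (2 / sqrt (real (card T) + 1))" for v :: "'i \<Rightarrow> nat"
  proof -
    define V where "V = sum v T"
    define Ks where "Ks = {k. H * k + V \<le> x \<and> x < H * k + V + 2 * H}"
    have sum: "(\<Sum>i\<in>T. of_bool (b i) * H + v i) = H * card {i \<in> T. b i} + V" for b
      using assms(1) by (simp add: V_def sum.distrib flip: sum_distrib_right)
        (simp add: Int_def conj_commute)
    have "emeasure (bind_pmf ?bern (\<lambda>b. return_pmf (\<lambda>i. if i \<in> T then of_bool (b i) * H + v i else 0))) ?E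
       = emeasure (map_pmf (\<lambda>b. card {i \<in> T. b i}) ?bern) Ks"
      unfolding map_pmf_def[symmetric] emeasure_map_pmf Ks_def
      by (rule arg_cong2[where f = emeasure]) (auto simp: sum)
    also have "map_pmf (\<lambda>b. card {i \<in> T. b i}) ?bern = binomial_pmf (card T) (1/2)"
      by (rule binomial_pmf_altdef'[symmetric]) (use assms in auto)
    also have "emeasure \<dots> Ks \<le> ennreal (2 / sqrt (real (card T) + 1))"
    proof (cases "Ks = {}")
      case False
      define k0 where "k0 = (LEAST k. k \<in> Ks)"
      have k0: "k0 \<in> Ks" using False LeastI_ex[of "\<lambda>k. k \<in> Ks"] unfolding k0_def by auto
      have "Ks \<subseteq> {k0, Suc k0}"
      proof
        fix k assume k: "k \<in> Ks"
        then have "k0 \<le> k" unfolding k0_def by (rule Least_le)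
        moreover have "H * k < H * (k0 + 2)" using k k0 unfolding Ks_def mem_Collect_eq by (simp add: algebra_simps)
        then have "k < k0 + 2" by (simp only: mult_less_cancel1)
        ultimately show "k \<in> {k0, Suc k0}" by auto
      qed
      then have "emeasure (binomial_pmf (card T) (1/2)) Ks \<le> emeasure (binomial_pmf (card T) (1/2)) {k0, Suc k0}"
        by (intro emeasure_mono) auto
      also have "\<dots> = ennreal (pmf (binomial_pmf (card T) (1/2)) k0 + pmf (binomial_pmf (card T) (1/2)) (Suc k0))"
        by (subst emeasure_measure_pmf_finite) (auto simp del: pmf_binomial simp: ennreal_plus)
      also have "\<dots> \<le> ennreal (2 / sqrt (real (card T) + 1))"
        using symmetric_binomial_pmf_le[of "card T" k0] symmetric_binomial_pmf_le[of "card T" "Suc k0"]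
        by (intro ennreal_leI) simp
      finally show ?thesis .
    qed simp
    finally show ?thesis .
  qed
  have "emeasure (Pi_pmf T 0 (\<lambda>_. pmf_of_set {..<2 * H})) ?E
     \<le> (\<integral>\<^sup>+v. ennreal (2 / sqrt (real (card T) + 1)) \<partial>Pi_pmf T 0 (\<lambda>_. pmf_of_set {..<H}))"
    unfolding eq emeasure_bind_pmf[of _ _ ?E] by (intro nn_integral_mono) (use inner in auto)
  then show ?thesis by simp
qed

text \<open>
  For given remaining summands a single uniform summand hits the required value with probability
  at most \<open>1 / (2 H)\<close>, and it can do so only if the sum of the others lies in an interval of length
  \<open>2 H\<close>.
\<close>

lemma pmf_uniform_sum_le:
  fixes T :: "'i set" and H :: nat
  assumes "finite T" "T \<noteq> {}" "0 < H"
  shows "pmf (map_pmf (\<lambda>u. sum u T) (Pi_pmf T 0 (\<lambda>_. pmf_of_set {..<2 * H}))) x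
    \<le> 1 / (real H * sqrt (real (card T)))"
proof -
  let ?U = "pmf_of_set {..<2 * H}"
  obtain t S where T: "T = insert t S" "t \<notin> S" using assms(2) by (meson equals0I mk_disjoint_insert)
  then have S: "finite S" using assms by simp
  have U: "{..<2 * H} \<noteq> {}" "finite {..<2 * H}" using assms by (auto simp: lessThan_empty_iff)
  have "ennreal (pmf (map_pmf (\<lambda>u. sum u T) (Pi_pmf T 0 (\<lambda>_. ?U))) x)
      = emeasure (Pi_pmf T 0 (\<lambda>_. ?U)) {u. sum u T = x}"
    unfolding ennreal_pmf_map by (simp add: vimage_def)
  also have "\<dots> = (\<integral>\<^sup>+y. indicator {u. sum u T = x} y \<partial>Pi_pmf T 0 (\<lambda>_. ?U))" by simp
  also have "\<dots> = (\<integral>\<^sup>+u. \<integral>\<^sup>+y. of_bool (y + sum u S = x) \<partial>?U \<partial>Pi_pmf S 0 (\<lambda>_. ?U))"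
  proof -
    have "(\<Sum>i\<in>S. (u(t := y)) i) = sum u S" for u and y :: nat
      using T by (intro sum.cong) auto
    then show ?thesis
      unfolding T(1) Pi_pmf_insert[OF S T(2)] pair_commute_pmf[of ?U]
      using T S by (simp add: nn_integral_pair_pmf' indicator_def of_bool_def)
  qed
  also have "\<dots> \<le> (\<integral>\<^sup>+u. ennreal (1 / (2 * real H)) * indicator {u. sum u S \<le> x \<and> x < sum u S + 2 * H} u \<partial>Pi_pmf S 0 (\<lambda>_. ?U))"
  proof (intro nn_integral_mono)
    fix u :: "'i \<Rightarrow> nat"
    have "(\<integral>\<^sup>+y. of_bool (y + sum u S = x) \<partial>?U) = (\<Sum>y<2*H. of_bool (y + sum u S = x)) / ennreal (2 * real H)"
      using nn_integral_pmf_of_set[OF U, of "\<lambda>y. of_bool (y + sum u S = x)"] by (simp add: of_nat_mult ennreal_of_nat_eq_real_of_nat)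
    also have "(\<Sum>y<2*H. of_bool (y + sum u S = x)) = (indicator {u. sum u S \<le> x \<and> x < sum u S + 2 * H} u :: ennreal)"
    proof -
      have "{y. y < 2 * H \<and> y + sum u S = x} = (if sum u S \<le> x \<and> x < sum u S + 2 * H then {x - sum u S} else {})"
        by auto
      moreover have "(\<Sum>y<2*H. of_bool (y + sum u S = x) :: ennreal) = of_nat (card {y. y < 2 * H \<and> y + sum u S = x})"
        by (simp add: Int_def)
      ultimately show ?thesis by auto
    qed
    finally show "(\<integral>\<^sup>+y. of_bool (y + sum u S = x) \<partial>?U) \<le> ennreal (1 / (2 * real H)) * indicator {u. sum u S \<le> x \<and> x < sum u S + 2 * H} u"
      using assms(3) divide_ennreal[of 1 "2 * real H"] by (auto simp: indicator_def)
  qed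
  also have "\<dots> = ennreal (1 / (2 * real H)) * emeasure (Pi_pmf S 0 (\<lambda>_. ?U)) {u. sum u S \<le> x \<and> x < sum u S + 2 * H}"
    by (simp add: nn_integral_cmult)
  also have "\<dots> \<le> ennreal (1 / (2 * real H)) * ennreal (2 / sqrt (real (card S) + 1))"
    by (intro mult_left_mono emeasure_uniform_sum_window_le S assms) auto
  also have "\<dots> = ennreal (1 / (real H * sqrt (real (card T))))"
    using S T by (simp add: add.commute flip: ennreal_mult')
  finally show ?thesis by (subst (asm) ennreal_le_iff) auto
qed

text \<open>
  A law that dominates \<open>q\<close> times another one is a mixture: the normalised difference is the
  residual law.
\<close>

lemma pmf_mixture_decomposition:
  assumes q: "0 \<le> q" "q < 1" and minor: "\<And>x. q * pmf s x \<le> pmf p x"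
  obtains r where "p = bernoulli_pmf q \<bind> (\<lambda>b. if b then s else r)"
proof
  define g where "g x = (pmf p x - q * pmf s x) / (1 - q)" for x
  define r where "r = embed_pmf g"
  have nn: "0 \<le> g x" for x using q minor[of x] by (simp add: g_def)
  have "(\<integral>\<^sup>+x. ennreal (1 - q) * ennreal (g x) \<partial>count_space UNIV) + ennreal q * (\<integral>\<^sup>+x. ennreal (pmf s x) \<partial>count_space UNIV)
     = (\<integral>\<^sup>+x. ennreal (1 - q) * ennreal (g x) + ennreal q * ennreal (pmf s x) \<partial>count_space UNIV)"
    by (simp add: nn_integral_add nn_integral_cmult)
  also have "\<dots> = (\<integral>\<^sup>+x. ennreal (pmf p x) \<partial>count_space UNIV)"
  proof (rule nn_integral_cong)
    fix x
    have "(1 - q) * g x + q * pmf s x = pmf p x" using q by (simp add: g_def)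
    then show "ennreal (1 - q) * ennreal (g x) + ennreal q * ennreal (pmf s x) = ennreal (pmf p x)"
      using q nn[of x] by (metis (no_types, lifting) diff_ge_0_iff_ge ennreal_mult ennreal_plus less_imp_le mult_nonneg_nonneg pmf_nonneg)
  qed
  finally have "ennreal (1 - q) * (\<integral>\<^sup>+x. ennreal (g x) \<partial>count_space UNIV) + ennreal q = 1"
    by (simp add: nn_integral_cmult nn_integral_pmf_eq_1)
  moreover have "ennreal (q + (1 - q)) = ennreal q + ennreal (1 - q)" using q by (intro ennreal_plus) auto
  then have "ennreal q + ennreal (1 - q) = 1" by (subst (asm) add_diff_eq) simp
  ultimately have "ennreal q + ennreal (1 - q) * (\<integral>\<^sup>+x. ennreal (g x) \<partial>count_space UNIV)
      = ennreal q + ennreal (1 - q)" by (simp only: add.commute)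
  then have "ennreal (1 - q) * (\<integral>\<^sup>+x. ennreal (g x) \<partial>count_space UNIV) = ennreal (1 - q) * 1"
    unfolding ennreal_add_left_cancel by simp
  then have one: "(\<integral>\<^sup>+x. ennreal (g x) \<partial>count_space UNIV) = 1"
    using q by (subst (asm) ennreal_mult_cancel_left) auto
  have pmf_r: "pmf r x = g x" for x
    unfolding r_def by (rule pmf_embed_pmf) (use nn one in auto)
  show "p = bernoulli_pmf q \<bind> (\<lambda>b. if b then s else r)"
  proof (rule pmf_eqI)
    fix x
    show "pmf p x = pmf (bernoulli_pmf q \<bind> (\<lambda>b. if b then s else r)) x"
      using q by (simp add: pmf_bind pmf_r g_def)
  qed
qed

lemma emeasure_two_sums_le:
  fixes T1 T2 :: "'i set" and p :: "'i \<Rightarrow> nat pmf"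
  assumes L: "finite L" and T: "T1 \<subseteq> L" "T2 \<subseteq> L" "T1 \<inter> T2 = {}" and X: "finite X1" "finite X2"
    and c1: "0 \<le> c1" "\<And>x. pmf (map_pmf (\<lambda>u. sum u T1) (Pi_pmf T1 0 p)) x \<le> c1"
    and c2: "0 \<le> c2" "\<And>x. pmf (map_pmf (\<lambda>u. sum u T2) (Pi_pmf T2 0 p)) x \<le> c2"
  shows "emeasure (Pi_pmf L 0 p) {u. sum u T1 \<in> X1 \<and> sum u T2 \<in> X2}
    \<le> ennreal ((real (card X1) * c1) * (real (card X2) * c2))"
proof -
  have fin: "finite T1" "finite T2" using L T by (auto intro: finite_subset)
  let ?P1 = "map_pmf (\<lambda>u. sum u T1) (Pi_pmf T1 0 p)" and ?P2 = "map_pmf (\<lambda>u. sum u T2) (Pi_pmf T2 0 p)"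
  have "map_pmf (\<lambda>u. (sum u T1, sum u T2)) (Pi_pmf L 0 p)
      = map_pmf (\<lambda>u. (sum u T1, sum u T2)) (Pi_pmf (T1 \<union> T2) 0 p)"
    using T L by (subst Pi_pmf_subset[of L "T1 \<union> T2"])
      (auto simp: pmf.map_comp o_def intro!: pmf.map_cong sum.cong)
  also have "\<dots> = map_pmf (\<lambda>(a, b). (sum a T1, sum b T2)) (pair_pmf (Pi_pmf T1 0 p) (Pi_pmf T2 0 p))"
    using T by (subst Pi_pmf_union[OF fin T(3)])
      (auto simp: pmf.map_comp o_def case_prod_unfold intro!: pmf.map_cong sum.cong)
  also have "\<dots> = pair_pmf ?P1 ?P2" by (rule map_pair)
  finally have law: "map_pmf (\<lambda>u. (sum u T1, sum u T2)) (Pi_pmf L 0 p) = pair_pmf ?P1 ?P2" .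
  have "emeasure (Pi_pmf L 0 p) {u. sum u T1 \<in> X1 \<and> sum u T2 \<in> X2}
      = emeasure (map_pmf (\<lambda>u. (sum u T1, sum u T2)) (Pi_pmf L 0 p)) (X1 \<times> X2)"
    by (simp add: vimage_def)
  also have "\<dots> = ennreal (measure_pmf.prob ?P1 X1 * measure_pmf.prob ?P2 X2)"
    unfolding law measure_pmf.emeasure_eq_measure
    using X by (subst measure_pmf_prob_product) (auto intro: countable_finite)
  also have "\<dots> \<le> ennreal ((real (card X1) * c1) * (real (card X2) * c2))"
  proof (intro ennreal_leI mult_mono)
    show "measure_pmf.prob ?P1 X1 \<le> real (card X1) * c1"
      unfolding measure_measure_pmf_finite[OF X(1)] by (rule sum_bounded_above) (rule c1(2))
    show "measure_pmf.prob ?P2 X2 \<le> real (card X2) * c2"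
      unfolding measure_measure_pmf_finite[OF X(2)] by (rule sum_bounded_above) (rule c2(2))
  qed (use c1 c2 in auto)
  finally show ?thesis .
qed

lemma card_nat_affine_interval_le:
  fixes A d \<rho> :: real
  assumes "0 < d" "0 \<le> \<rho>"
  shows "finite {x::nat. \<bar>A + d * real x\<bar> \<le> \<rho>}"
    and "real (card {x::nat. \<bar>A + d * real x\<bar> \<le> \<rho>}) \<le> 2 * \<rho> / d + 1"
proof -
  let ?X = "{x::nat. \<bar>A + d * real x\<bar> \<le> \<rho>}"
  let ?lo = "(- \<rho> - A) / d" and ?hi = "(\<rho> - A) / d"
  have sub: "int ` ?X \<subseteq> {\<lceil>?lo\<rceil>..\<lfloor>?hi\<rfloor>}"
  proof clarify
    fix x :: nat assume "\<bar>A + d * real x\<bar> \<le> \<rho>"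
    then have "?lo \<le> real x" "real x \<le> ?hi" using assms by (auto simp: field_simps abs_le_iff)
    then show "int x \<in> {\<lceil>?lo\<rceil>..\<lfloor>?hi\<rfloor>}" by (auto simp: ceiling_le_iff le_floor_iff)
  qed
  then have "finite (int ` ?X)" by (rule finite_subset) simp
  then show "finite ?X" by (rule finite_imageD) simp
  have "card ?X = card (int ` ?X)" by (simp add: card_image)
  also have "\<dots> \<le> card {\<lceil>?lo\<rceil>..\<lfloor>?hi\<rfloor>}" by (rule card_mono[OF _ sub]) simp
  finally have "real (card ?X) \<le> real (nat (\<lfloor>?hi\<rfloor> - \<lceil>?lo\<rceil> + 1))" by simp
  also have "\<dots> \<le> ?hi - ?lo + 1"
  proof -
    have "of_int (\<lfloor>?hi\<rfloor> - \<lceil>?lo\<rceil> + 1) \<le> ?hi - ?lo + 1"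
      using of_int_floor_le[of ?hi] le_of_int_ceiling[of ?lo] unfolding of_int_add of_int_diff of_int_1 by linarith
    moreover have "0 \<le> ?hi - ?lo + 1" using assms by (simp flip: diff_divide_distrib)
    ultimately show ?thesis by (cases "0 \<le> \<lfloor>?hi\<rfloor> - \<lceil>?lo\<rceil> + 1") simp_all
  qed
  also have "\<dots> = 2 * \<rho> / d + 1" using assms by (simp add: field_simps)
  finally show "real (card ?X) \<le> 2 * \<rho> / d + 1" .
qed

text \<open>
  The offsets \<open>A1\<close> and \<open>A2\<close> may depend on the variables outside the two index sets. Conditioning
  on these variables turns the offsets into constants and leaves two independent sums.
\<close>

lemma emeasure_two_affine_sums_le:
  fixes T1 T2 :: "'i set" and p :: "'i \<Rightarrow> nat pmf" and A1 A2 :: "('i \<Rightarrow> nat) \<Rightarrow> real"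
  assumes L: "finite L" and T: "T1 \<subseteq> L" "T2 \<subseteq> L" "T1 \<inter> T2 = {}" and d: "0 < d" "0 \<le> \<rho>"
    and A1: "\<And>u u'. (\<And>i. i \<in> L - (T1 \<union> T2) \<Longrightarrow> u i = u' i) \<Longrightarrow> A1 u = A1 u'"
    and A2: "\<And>u u'. (\<And>i. i \<in> L - (T1 \<union> T2) \<Longrightarrow> u i = u' i) \<Longrightarrow> A2 u = A2 u'"
    and c1: "0 \<le> c1" "\<And>x. pmf (map_pmf (\<lambda>u. sum u T1) (Pi_pmf T1 0 p)) x \<le> c1"
    and c2: "0 \<le> c2" "\<And>x. pmf (map_pmf (\<lambda>u. sum u T2) (Pi_pmf T2 0 p)) x \<le> c2"
  shows "emeasure (Pi_pmf L 0 p)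
      {u. \<bar>A1 u + d * real (sum u T1)\<bar> \<le> \<rho> \<and> \<bar>A2 u + d * real (sum u T2)\<bar> \<le> \<rho>}
    \<le> ennreal (((2 * \<rho> / d + 1) * c1) * ((2 * \<rho> / d + 1) * c2))" (is "emeasure _ ?E \<le> ?c")
proof -
  let ?R = "L - (T1 \<union> T2)" and ?T = "T1 \<union> T2"
  let ?X = "\<lambda>A. {x::nat. \<bar>A + d * real x\<bar> \<le> \<rho>}"
  have fin: "finite ?R" "finite ?T" using L T by (auto intro: finite_subset)
  have "L = ?R \<union> ?T" using T by auto
  then have "Pi_pmf L 0 p = Pi_pmf (?R \<union> ?T) 0 p" by simp
  also have "\<dots> = map_pmf (\<lambda>(g, h) i. if i \<in> ?R then g i else h i) (pair_pmf (Pi_pmf ?R 0 p) (Pi_pmf ?T 0 p))"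
    by (rule Pi_pmf_union[OF fin]) auto
  finally have law: "Pi_pmf L 0 p =
    map_pmf (\<lambda>(g, h) i. if i \<in> ?R then g i else h i) (pair_pmf (Pi_pmf ?R 0 p) (Pi_pmf ?T 0 p))" .
  have "emeasure (Pi_pmf L 0 p) ?E = (\<integral>\<^sup>+u. indicator ?E u \<partial>Pi_pmf L 0 p)"
    by (rule nn_integral_indicator[symmetric]) simp
  also have "\<dots> = (\<integral>\<^sup>+g. \<integral>\<^sup>+h. indicator ?E (\<lambda>i. if i \<in> ?R then g i else h i) \<partial>Pi_pmf ?T 0 p \<partial>Pi_pmf ?R 0 p)"
    unfolding law nn_integral_map_pmf nn_integral_pair_pmf' case_prod_conv ..
  also have "\<dots> \<le> (\<integral>\<^sup>+g. ?c \<partial>Pi_pmf ?R 0 p)"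
  proof (intro nn_integral_mono)
    fix g :: "'i \<Rightarrow> nat"
    let ?m = "\<lambda>h i. if i \<in> ?R then g i else h i"
    have "A1 (?m h) = A1 g" "A2 (?m h) = A2 g" for h by (rule A1 A2; simp)+
    moreover have "sum (?m h) T1 = sum h T1" "sum (?m h) T2 = sum h T2" for h :: "'i \<Rightarrow> nat"
      by (auto intro: sum.cong)
    ultimately have "(\<integral>\<^sup>+h. indicator ?E (?m h) \<partial>Pi_pmf ?T 0 p)
       = (\<integral>\<^sup>+h. indicator {u. sum u T1 \<in> ?X (A1 g) \<and> sum u T2 \<in> ?X (A2 g)} h \<partial>Pi_pmf ?T 0 p)"
      by (intro nn_integral_cong) (simp add: indicator_def)
    also have "\<dots> = emeasure (Pi_pmf ?T 0 p) {u. sum u T1 \<in> ?X (A1 g) \<and> sum u T2 \<in> ?X (A2 g)}"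
      by (subst nn_integral_indicator) auto
    also have "\<dots> \<le> ennreal ((real (card (?X (A1 g))) * c1) * (real (card (?X (A2 g))) * c2))"
      by (intro emeasure_two_sums_le fin c1 c2 T card_nat_affine_interval_le d) auto
    also have "\<dots> \<le> ?c"
      using d c1 c2 by (intro ennreal_leI mult_mono mult_right_mono card_nat_affine_interval_le) auto
    finally show "(\<integral>\<^sup>+h. indicator ?E (?m h) \<partial>Pi_pmf ?T 0 p) \<le> ?c" .
  qed
  finally show ?thesis by simp
qed

section \<open>Windows containing a single point\<close>

definition points_before_window :: "nat \<Rightarrow> (nat \<Rightarrow> nat \<Rightarrow> nat) \<Rightarrow> nat \<Rightarrow> nat" where
  "points_before_window B w i = (\<Sum>i'<i. \<Sum>l<B. w i' l)"

text \<open>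
  The windows are numbered by \<open>i < L\<close> and the cells in a window by \<open>l < B\<close>; \<open>w i l\<close> is the number of
  points in a cell. The argument of \<open>g\<close> is the number of points up to the end of the current cell,
  and this is the index of the direction that the walk follows at that time. With \<open>g\<close> a coordinate of the
  directions, this is a Riemann sum for the walk, up to the factor given by the length of a cell.
\<close>

definition grid_sum :: "nat \<Rightarrow> nat \<Rightarrow> (nat \<Rightarrow> nat \<Rightarrow> nat) \<Rightarrow> (nat \<Rightarrow> real) \<Rightarrow> real" where
  "grid_sum L B w g = (\<Sum>i<L. \<Sum>l<B. g (points_before_window B w i + (\<Sum>l'<Suc l. w i l')))"

definition single_point :: "nat \<Rightarrow> nat \<Rightarrow> nat" where
  "single_point u l = of_bool (l = u)"

text \<open>
  The flags \<open>\<xi>\<close> select the windows that consist of a single point at the cell \<open>u i\<close>; the other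
  windows are given by \<open>r\<close>.
\<close>

definition mixed_windows ::
  "(nat \<Rightarrow> bool) \<Rightarrow> (nat \<Rightarrow> nat \<Rightarrow> nat) \<Rightarrow> (nat \<Rightarrow> nat) \<Rightarrow> nat \<Rightarrow> nat \<Rightarrow> nat" where
  "mixed_windows \<xi> r u i = (if \<xi> i then single_point (u i) else r i)"

text \<open>
  The number of points before window \<open>i\<close> in \<open>mixed_windows\<close>, written without the positions \<open>u\<close>.
\<close>

definition base_count :: "nat \<Rightarrow> (nat \<Rightarrow> bool) \<Rightarrow> (nat \<Rightarrow> nat \<Rightarrow> nat) \<Rightarrow> nat \<Rightarrow> nat" where
  "base_count B \<xi> r i = (\<Sum>i'<i. if \<xi> i' then 1 else \<Sum>l<B. r i' l)"

lemma points_before_mixed_windows: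
  assumes "\<And>j. j < L \<Longrightarrow> u j < B" "i \<le> L"
  shows "points_before_window B (mixed_windows \<xi> r u) i = base_count B \<xi> r i"
  unfolding points_before_window_def base_count_def
proof (rule sum.cong[OF refl])
  fix j assume "j \<in> {..<i}"
  then have "u j < B" using assms by auto
  then show "(\<Sum>l<B. mixed_windows \<xi> r u j l) = (if \<xi> j then 1 else \<Sum>l<B. r j l)"
    by (simp add: mixed_windows_def single_point_def of_bool_def sum.delta)
qed

lemma sum_single_point_window:
  fixes g :: "nat \<Rightarrow> real"
  assumes "u < B"
  shows "(\<Sum>l<B. g (c + (\<Sum>l'<Suc l. single_point u l'))) = real B * g (Suc c) + real u * (g c - g (Suc c))"
proof -
  have count: "(\<Sum>l'<Suc l. single_point u l') = of_bool (u \<le> l)" for l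
    by (simp add: single_point_def of_bool_def sum.delta less_Suc_eq_le del: sum.lessThan_Suc)
  have "(\<Sum>l<B. g (c + (\<Sum>l'<Suc l. single_point u l'))) = (\<Sum>l<B. if l < u then g c else g (Suc c))"
    unfolding count by (intro sum.cong) auto
  also have "\<dots> = (\<Sum>l<B. g (Suc c) + (if l < u then g c - g (Suc c) else 0))"
    by (intro sum.cong) auto
  also have "\<dots> = real B * g (Suc c) + (\<Sum>l<B. if l < u then g c - g (Suc c) else 0)"
    by (simp add: sum.distrib)
  also have "(\<Sum>l<B. if l < u then g c - g (Suc c) else 0) = (\<Sum>l<u. g c - g (Suc c))"
    using assms by (intro sum.mono_neutral_cong_right) auto
  finally show ?thesis by simp
qed

text \<open>
  The number of points in a window with a single point does not depend on the position of that
  point, so neither do the indices of the points in the later windows. Hence the positions enter the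
  grid sum linearly, without interaction.
\<close>

lemma grid_sum_mixed_windows:
  assumes u: "\<And>j. j < L \<Longrightarrow> u j < B"
  shows "grid_sum L B (mixed_windows \<xi> r u) g = (\<Sum>i<L. let c = base_count B \<xi> r i in
      if \<xi> i then real B * g (Suc c) + real (u i) * (g c - g (Suc c))
      else \<Sum>l<B. g (c + (\<Sum>l'<Suc l. r i l')))"
  unfolding grid_sum_def
proof (rule sum.cong[OF refl])
  fix i assume "i \<in> {..<L}"
  then have "u i < B" "points_before_window B (mixed_windows \<xi> r u) i = base_count B \<xi> r i"
    using u points_before_mixed_windows[of L u B i] by auto
  then show "(\<Sum>l<B. g (points_before_window B (mixed_windows \<xi> r u) i + (\<Sum>l'<Suc l. mixed_windows \<xi> r u i l')))
    = (let c = base_count B \<xi> r i in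
      if \<xi> i then real B * g (Suc c) + real (u i) * (g c - g (Suc c))
      else \<Sum>l<B. g (c + (\<Sum>l'<Suc l. r i l')))"
    by (cases "\<xi> i") (simp_all only: sum_single_point_window mixed_windows_def Let_def if_True if_False)
qed

text \<open>
  The sets \<open>T1\<close> and \<open>T2\<close> are single-point windows whose point moves the first, respectively the
  second, grid sum by \<open>2\<close> per cell and leaves the other one unchanged. All other windows contribute
  to the offsets.
\<close>

lemma emeasure_grid_sums_small_le:
  fixes g1 g2 :: "nat \<Rightarrow> real" and T1 T2 :: "nat set" and \<xi> :: "nat \<Rightarrow> bool"
    and r :: "nat \<Rightarrow> nat \<Rightarrow> nat" and H :: nat
  defines "c \<equiv> base_count (2 * H) \<xi> r"
  assumes pos: "0 < H" "0 < m" "0 < \<delta>" "0 \<le> \<rho>"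
    and T1: "T1 \<subseteq> {i. i < L \<and> \<xi> i}" "\<And>i. i \<in> T1 \<Longrightarrow> g1 (c i) - g1 (Suc (c i)) = 2"
      "\<And>i. i \<in> T2 \<Longrightarrow> g1 (c i) - g1 (Suc (c i)) = 0"
    and T2: "T2 \<subseteq> {i. i < L \<and> \<xi> i}" "\<And>i. i \<in> T2 \<Longrightarrow> g2 (c i) - g2 (Suc (c i)) = 2"
      "\<And>i. i \<in> T1 \<Longrightarrow> g2 (c i) - g2 (Suc (c i)) = 0"
    and card: "m \<le> card T1" "m \<le> card T2"
  shows "emeasure (Pi_pmf {..<L} 0 (\<lambda>_. pmf_of_set {..<2 * H}))
      {u. \<bar>\<delta> * grid_sum L (2 * H) (mixed_windows \<xi> r u) g1\<bar> \<le> \<rho> \<and>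
          \<bar>\<delta> * grid_sum L (2 * H) (mixed_windows \<xi> r u) g2\<bar> \<le> \<rho>}
    \<le> ennreal ((\<rho> / \<delta> + 1)\<^sup>2 / (real H ^ 2 * real m))"
proof -
  let ?P = "Pi_pmf {..<L} 0 (\<lambda>_. pmf_of_set {..<2 * H})"
  \<comment> \<open>The part of the grid sum that ignores the points in \<open>T1 \<union> T2\<close>.\<close>
  define A where "A g u = \<delta> * (\<Sum>i<L. 
      if \<xi> i then real (2 * H) * g (Suc (c i)) + (if i \<in> T1 \<union> T2 then 0 else real (u i) * (g (c i) - g (Suc (c i))))
      else \<Sum>l<2 * H. g (c i + (\<Sum>l'<Suc l. r i l')))" for g and u :: "nat \<Rightarrow> nat"
  have disj: "T1 \<inter> T2 = {}" using T1(2) T1(3) by fastforce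
  have split: "\<delta> * grid_sum L (2 * H) (mixed_windows \<xi> r u) g = A g u + (2 * \<delta>) * real (sum u S)"
    if u: "\<And>j. j < L \<Longrightarrow> u j < 2 * H" and S: "S \<subseteq> T1 \<union> T2" "\<And>i. i \<in> S \<Longrightarrow> g (c i) - g (Suc (c i)) = 2"
      "\<And>i. i \<in> T1 \<union> T2 - S \<Longrightarrow> g (c i) - g (Suc (c i)) = 0" for u g S
  proof -
    have expand: "grid_sum L (2 * H) (mixed_windows \<xi> r u) g = (\<Sum>i<L.
        if \<xi> i then real (2 * H) * g (Suc (c i)) + real (u i) * (g (c i) - g (Suc (c i)))
        else \<Sum>l<2 * H. g (c i + (\<Sum>l'<Suc l. r i l')))"
      using grid_sum_mixed_windows[where L = L and u = u and B = "2 * H" and \<xi> = \<xi> and r = r and g = g] u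
      unfolding c_def Let_def by blast
    have "grid_sum L (2 * H) (mixed_windows \<xi> r u) g = (\<Sum>i<L.
      (if \<xi> i then real (2 * H) * g (Suc (c i)) + (if i \<in> T1 \<union> T2 then 0 else real (u i) * (g (c i) - g (Suc (c i))))
      else \<Sum>l<2 * H. g (c i + (\<Sum>l'<Suc l. r i l'))) + (if i \<in> S then 2 * real (u i) else 0))"
      unfolding expand
    proof (rule sum.cong[OF refl])
      fix i assume "i \<in> {..<L}"
      consider "i \<in> S" "\<xi> i" | "i \<notin> S" "i \<in> T1 \<union> T2" "\<xi> i" | "i \<notin> T1 \<union> T2" "i \<notin> S"
        using S(1) T1(1) T2(1) by blast
      then show "(if \<xi> i then real (2 * H) * g (Suc (c i)) + real (u i) * (g (c i) - g (Suc (c i)))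
         else \<Sum>l<2 * H. g (c i + (\<Sum>l'<Suc l. r i l')))
       = (if \<xi> i then real (2 * H) * g (Suc (c i)) + (if i \<in> T1 \<union> T2 then 0 else real (u i) * (g (c i) - g (Suc (c i))))
      else \<Sum>l<2 * H. g (c i + (\<Sum>l'<Suc l. r i l'))) + (if i \<in> S then 2 * real (u i) else 0)"
      proof cases
        case 1
        then have "i \<in> T1 \<union> T2" using S(1) by blast
        then show ?thesis using 1 S(2)[of i] by simp
      next
        case 2
        then show ?thesis using S(3)[of i] by simp
      next
        case 3
        then show ?thesis by simp
      qed
    qed
    also have "\<dots> = A g u / \<delta> + (\<Sum>i<L. if i \<in> S then 2 * real (u i) else 0)"
      using pos by (simp add: sum.distrib A_def)
    also have "(\<Sum>i<L. if i \<in> S then 2 * real (u i) else 0) = (\<Sum>i\<in>S. 2 * real (u i))"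
      using S(1) T1(1) T2(1) by (intro sum.mono_neutral_cong_right) auto
    finally show ?thesis using pos by (simp add: sum_distrib_left algebra_simps)
  qed
  have range: "u j < 2 * H" if "u \<in> set_pmf ?P" "j < L" for u j
  proof -
    have "u \<in> PiE_dflt {..<L} 0 (set_pmf \<circ> (\<lambda>_. pmf_of_set {..<2 * H}))"
      using that(1) set_Pi_pmf_subset'[of "{..<L}" 0 "\<lambda>_. pmf_of_set {..<2 * H}"] by auto
    then show ?thesis using that(2) pos by (auto simp: PiE_dflt_def lessThan_empty_iff)
  qed
  let ?E = "{u. \<bar>A g1 u + (2 * \<delta>) * real (sum u T1)\<bar> \<le> \<rho> \<and> \<bar>A g2 u + (2 * \<delta>) * real (sum u T2)\<bar> \<le> \<rho>}"
  have "emeasure ?P {u. \<bar>\<delta> * grid_sum L (2 * H) (mixed_windows \<xi> r u) g1\<bar> \<le> \<rho> \<and>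
          \<bar>\<delta> * grid_sum L (2 * H) (mixed_windows \<xi> r u) g2\<bar> \<le> \<rho>} \<le> emeasure ?P ?E"
  proof (rule emeasure_mono_AE)
    show "AE u in ?P. u \<in> {u. \<bar>\<delta> * grid_sum L (2 * H) (mixed_windows \<xi> r u) g1\<bar> \<le> \<rho> \<and>
          \<bar>\<delta> * grid_sum L (2 * H) (mixed_windows \<xi> r u) g2\<bar> \<le> \<rho>} \<longrightarrow> u \<in> ?E"
      unfolding AE_measure_pmf_iff
    proof (intro ballI impI)
      fix u assume u: "u \<in> set_pmf ?P"
        and h: "u \<in> {u. \<bar>\<delta> * grid_sum L (2 * H) (mixed_windows \<xi> r u) g1\<bar> \<le> \<rho> \<and>
          \<bar>\<delta> * grid_sum L (2 * H) (mixed_windows \<xi> r u) g2\<bar> \<le> \<rho>}"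
      have "\<delta> * grid_sum L (2 * H) (mixed_windows \<xi> r u) g1 = A g1 u + (2 * \<delta>) * real (sum u T1)"
        by (rule split) (use u range T1 in auto)
      moreover have "\<delta> * grid_sum L (2 * H) (mixed_windows \<xi> r u) g2 = A g2 u + (2 * \<delta>) * real (sum u T2)"
        by (rule split) (use u range T2 in auto)
      ultimately show "u \<in> ?E" using h by simp
    qed
  qed simp
  also have "\<dots> \<le> ennreal (((2 * \<rho> / (2 * \<delta>) + 1) * (1 / (real H * sqrt (real m))))
      * ((2 * \<rho> / (2 * \<delta>) + 1) * (1 / (real H * sqrt (real m)))))"
  proof (rule emeasure_two_affine_sums_le)
    show "A g1 u = A g1 u'" if "\<And>i. i \<in> {..<L} - (T1 \<union> T2) \<Longrightarrow> u i = u' i" for u u'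
      unfolding A_def by (intro arg_cong2[where f = "(*)"] refl sum.cong if_cong) (use that in auto)
    show "A g2 u = A g2 u'" if "\<And>i. i \<in> {..<L} - (T1 \<union> T2) \<Longrightarrow> u i = u' i" for u u'
      unfolding A_def by (intro arg_cong2[where f = "(*)"] refl sum.cong if_cong) (use that in auto)
    have "pmf (map_pmf (\<lambda>u. sum u S) (Pi_pmf S 0 (\<lambda>_. pmf_of_set {..<2 * H}))) x \<le> 1 / (real H * sqrt (real m))"
      if "S \<subseteq> {i. i < L \<and> \<xi> i}" "m \<le> card S" for S :: "nat set" and x
    proof -
      have "finite S" "S \<noteq> {}" using that pos finite_subset by fastforce+
      then have "pmf (map_pmf (\<lambda>u. sum u S) (Pi_pmf S 0 (\<lambda>_. pmf_of_set {..<2 * H}))) x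
         \<le> 1 / (real H * sqrt (real (card S)))"
        using pos by (intro pmf_uniform_sum_le)
      also have "\<dots> \<le> 1 / (real H * sqrt (real m))"
        using that pos by (intro divide_left_mono mult_left_mono mult_pos_pos) auto
      finally show ?thesis .
    qed
    from this[OF T1(1) card(1)] this[OF T2(1) card(2)]
    show "pmf (map_pmf (\<lambda>u. sum u T1) (Pi_pmf T1 0 (\<lambda>_. pmf_of_set {..<2 * H}))) x \<le> 1 / (real H * sqrt (real m))"
      "pmf (map_pmf (\<lambda>u. sum u T2) (Pi_pmf T2 0 (\<lambda>_. pmf_of_set {..<2 * H}))) x \<le> 1 / (real H * sqrt (real m))" for x
      by auto
  qed (use T1(1) T2(1) disj pos in auto)
  also have "((2 * \<rho> / (2 * \<delta>) + 1) * (1 / (real H * sqrt (real m))))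
      * ((2 * \<rho> / (2 * \<delta>) + 1) * (1 / (real H * sqrt (real m)))) = (\<rho> / \<delta> + 1)\<^sup>2 / (real H ^ 2 * real m)"
    using pos by (simp add: power2_eq_square)
  finally show ?thesis .
qed

text \<open>
  All randomness is drawn first except for the positions \<open>u\<close> of the single points, which come
  last and are exactly uniform and independent of everything drawn before. The hypothesis \<open>minor\<close>
  compares the law of a window with that of a uniformly placed single point.
\<close>

lemma Pi_pmf_window_mixture:
  fixes p :: "nat \<Rightarrow> (nat \<Rightarrow> nat) pmf"
  assumes B: "0 < B" and q: "\<And>i. i < L \<Longrightarrow> 0 \<le> q i \<and> q i < 1"
    and minor: "\<And>i u. i < L \<Longrightarrow> u < B \<Longrightarrow> q i \<le> real B * pmf (p i) (single_point u)"
  obtains rest where "Pi_pmf {..<L} (\<lambda>_. 0) p =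
    Pi_pmf {..<L} False (\<lambda>i. bernoulli_pmf (q i)) \<bind> (\<lambda>\<xi>.
    Pi_pmf {..<L} (\<lambda>_. 0) rest \<bind> (\<lambda>w.
    Pi_pmf {..<L} 0 (\<lambda>_. pmf_of_set {..<B}) \<bind> (\<lambda>u.
      return_pmf (\<lambda>i. if i < L then mixed_windows \<xi> w u i else (\<lambda>_. 0)))))"
proof -
  let ?U = "pmf_of_set {..<B}"
  have ne: "{..<B} \<noteq> {}" using B by (simp add: lessThan_empty_iff)
  have inj: "inj_on single_point {..<B}"
    by (rule inj_onI) (metis single_point_def of_bool_eq_iff)
  have "\<exists>s. p i = bernoulli_pmf (q i) \<bind> (\<lambda>b. if b then map_pmf single_point ?U else s)" if i: "i < L" for i
  proof -
    have "q i * pmf (map_pmf single_point ?U) x \<le> pmf (p i) x" for x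
    proof (cases "x \<in> single_point ` {..<B}")
      case True
      then obtain u where u: "u < B" "x = single_point u" by auto
      then show ?thesis
        using minor[OF i u(1)] B inj ne by (simp add: map_pmf_of_set_inj card_image field_simps)
    next
      case False
      then show ?thesis using inj ne by (simp add: map_pmf_of_set_inj)
    qed
    then show ?thesis using pmf_mixture_decomposition[of "q i" "map_pmf single_point ?U" "p i"] q[OF i] by metis
  qed
  then have "\<forall>i. \<exists>s. i < L \<longrightarrow> p i = bernoulli_pmf (q i) \<bind> (\<lambda>b. if b then map_pmf single_point ?U else s)"
    by blast
  then obtain rest where rest: "\<And>i. i < L \<Longrightarrow> p i = bernoulli_pmf (q i) \<bind> (\<lambda>b. if b then map_pmf single_point ?U else rest i)"
    by metis
  have p: "p i = bernoulli_pmf (q i) \<bind> (\<lambda>b. rest i \<bind> (\<lambda>w. ?U \<bind> (\<lambda>u. return_pmf (if b then single_point u else w))))"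
    if "i < L" for i
    unfolding rest[OF that]
    by (intro bind_pmf_cong refl) (auto simp: map_pmf_def bind_return_pmf')
  have "Pi_pmf {..<L} (\<lambda>_. 0) p = Pi_pmf {..<L} (\<lambda>_. 0)
      (\<lambda>i. bernoulli_pmf (q i) \<bind> (\<lambda>b. rest i \<bind> (\<lambda>w. ?U \<bind> (\<lambda>u. return_pmf (if b then single_point u else w)))))"
    by (rule Pi_pmf_cong) (use p in auto)
  also have "\<dots> = Pi_pmf {..<L} False (\<lambda>i. bernoulli_pmf (q i)) \<bind> (\<lambda>\<xi>.
    Pi_pmf {..<L} (\<lambda>_. 0) rest \<bind> (\<lambda>w.
    Pi_pmf {..<L} 0 (\<lambda>_. ?U) \<bind> (\<lambda>u.
      return_pmf (\<lambda>i. if i < L then mixed_windows \<xi> w u i else (\<lambda>_. 0)))))"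
    by (simp add: Pi_pmf_bind[where d' = False] Pi_pmf_bind[where d' = "\<lambda>_. 0 :: nat"] 
        Pi_pmf_bind[where d' = "0 :: nat"] mixed_windows_def cong: if_cong)
  finally show ?thesis by (rule that)
qed

section \<open>Paths with prescribed jump times\<close>

locale jump_times =
  fixes s :: "nat \<Rightarrow> real"
  assumes s_zero: "s 0 = 0" and s_mono: "mono s" and s_finite: "\<And>T. finite {k. s k \<le> T}"
begin

lemma s_nonneg: "0 \<le> s k"
  using monoD[OF s_mono, of 0 k] by (simp add: s_zero)

lemma ex_late_jump: "\<exists>L. t < s L"
proof (rule ccontr)
  assume "\<not> (\<exists>L. t < s L)"
  then have "{k. s k \<le> t} = UNIV" by (auto simp: not_less)
  then show False using s_finite[of t] by simp
qed

lemma le_jump_index_iff: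
  assumes "0 \<le> t"
  shows "k \<le> jump_index s t \<longleftrightarrow> s k \<le> t"
proof -
  let ?A = "{k. s k \<le> t}"
  have "?A \<noteq> {}" using assms s_zero by (metis (mono_tags) empty_iff mem_Collect_eq)
  then have "jump_index s t = Max ?A" unfolding jump_index_def by (rule cSup_eq_Max[OF s_finite])
  moreover have "Max ?A \<in> ?A" using \<open>?A \<noteq> {}\<close> s_finite by (intro Max_in)
  ultimately show ?thesis
    using Max_ge[OF s_finite[of t], of k] monoD[OF s_mono, of k "Max ?A"] by auto
qed

text \<open>
  Cutting each flight interval off at time \<open>t\<close> gives a formula whose summation range does not
  depend on \<open>t\<close>, so that increments of the walk can be compared term by term.
\<close>

lemma walk_eq_sum:
  fixes v :: "nat \<Rightarrow> real ^ 'd"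
  assumes t: "0 \<le> t" and L: "t < s L"
  shows "walk s v t = (\<Sum>k<L. (min t (s (Suc k)) - min t (s k)) *\<^sub>R v k)"
proof -
  define N where "N = jump_index s t"
  have iff: "k \<le> N \<longleftrightarrow> s k \<le> t" for k unfolding N_def by (rule le_jump_index_iff[OF t])
  have NL: "N < L" using iff[of L] L by auto
  have "(\<Sum>k<L. (min t (s (Suc k)) - min t (s k)) *\<^sub>R v k)
     = (\<Sum>k<Suc N. (min t (s (Suc k)) - min t (s k)) *\<^sub>R v k)"
  proof (rule sum.mono_neutral_right)
    show "\<forall>k\<in>{..<L} - {..<Suc N}. (min t (s (Suc k)) - min t (s k)) *\<^sub>R v k = 0"
    proof
      fix k assume "k \<in> {..<L} - {..<Suc N}"
      then have "t < s k" "t < s (Suc k)" using iff[of k] iff[of "Suc k"] by auto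
      then show "(min t (s (Suc k)) - min t (s k)) *\<^sub>R v k = 0" by simp
    qed
  qed (use NL in auto)
  also have "\<dots> = (\<Sum>k<N. (min t (s (Suc k)) - min t (s k)) *\<^sub>R v k)
      + (min t (s (Suc N)) - min t (s N)) *\<^sub>R v N" by simp
  also have "(\<Sum>k<N. (min t (s (Suc k)) - min t (s k)) *\<^sub>R v k) = (\<Sum>k<N. (s (Suc k) - s k) *\<^sub>R v k)"
  proof (rule sum.cong[OF refl])
    fix k assume "k \<in> {..<N}"
    then have "s k \<le> t" "s (Suc k) \<le> t" using iff[of k] iff[of "Suc k"] by auto
    then show "(min t (s (Suc k)) - min t (s k)) *\<^sub>R v k = (s (Suc k) - s k) *\<^sub>R v k" by simp
  qed
  also have "min t (s (Suc N)) - min t (s N) = t - s N"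
    using iff[of N] iff[of "Suc N"] by simp
  finally show ?thesis unfolding walk_def N_def by simp
qed

lemma walk_zero: "walk s v 0 = 0"
proof -
  obtain L where "0 < s L" using ex_late_jump by blast
  then show ?thesis by (simp add: walk_eq_sum s_nonneg)
qed

lemma walk_component_lipschitz:
  fixes v :: "nat \<Rightarrow> real ^ 'd"
  assumes t: "0 \<le> t" "t \<le> t'" and v: "\<And>k. \<bar>v k $ a\<bar> \<le> 1"
  shows "\<bar>walk s v t' $ a - walk s v t $ a\<bar> \<le> t' - t"
proof -
  obtain L where L: "t' < s L" using ex_late_jump by blast
  define \<phi> where "\<phi> u k = min u (s (Suc k)) - min u (s k)" for u k
  have mono: "\<phi> t k \<le> \<phi> t' k" for k
    using t(2) monoD[OF s_mono, of k "Suc k"] unfolding \<phi>_def by (auto simp: min_def)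
  have total: "(\<Sum>k<L. \<phi> u k) = u" if "0 \<le> u" "u \<le> t'" for u
    unfolding \<phi>_def using that L by (subst sum_lessThan_telescope) (simp add: s_zero)
  have "walk s v t' $ a - walk s v t $ a = (\<Sum>k<L. (\<phi> t' k - \<phi> t k) * v k $ a)"
  proof -
    have "walk s v u $ a = (\<Sum>k<L. \<phi> u k * v k $ a)" if "0 \<le> u" "u \<le> t'" for u
      unfolding \<phi>_def using that L by (subst walk_eq_sum[of u L]) auto
    then show ?thesis using t by (simp add: sum_subtractf left_diff_distrib)
  qed
  also have "\<bar>\<dots>\<bar> \<le> (\<Sum>k<L. \<bar>(\<phi> t' k - \<phi> t k) * v k $ a\<bar>)" by (rule sum_abs)
  also have "\<dots> \<le> (\<Sum>k<L. \<phi> t' k - \<phi> t k)"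
  proof (rule sum_mono)
    fix k show "\<bar>(\<phi> t' k - \<phi> t k) * v k $ a\<bar> \<le> \<phi> t' k - \<phi> t k"
      using mono[of k] v[of k] by (simp add: abs_mult mult_left_le)
  qed
  also have "\<dots> = t' - t" using t total by (simp add: sum_subtractf)
  finally show ?thesis .
qed

lemma points_before_eq: "{k. 1 \<le> k \<and> s k < b} = {1..card {k. 1 \<le> k \<and> s k < b}}"
proof -
  let ?A = "{k. 1 \<le> k \<and> s k < b}"
  have fin: "finite ?A" by (rule finite_subset[OF _ s_finite[of b]]) auto
  show ?thesis
  proof (cases "?A = {}")
    case False
    have "?A = {1..Max ?A}"
    proof (intro equalityI subsetI)
      fix k assume "k \<in> {1..Max ?A}"
      moreover have "Max ?A \<in> ?A" using fin False by (rule Max_in)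
      ultimately show "k \<in> ?A" using monoD[OF s_mono, of k "Max ?A"] by auto
    qed (use fin in auto)
    then show ?thesis by (metis card_atLeastAtMost diff_Suc_1)
  next
    case True
    then show ?thesis unfolding True by simp
  qed
qed

lemma walk_increment_between_jumps:
  fixes v :: "nat \<Rightarrow> real ^ 'd"
  assumes ab: "0 \<le> a" "a \<le> b" and no: "\<And>k. 1 \<le> k \<Longrightarrow> s k \<notin> {a..<b}"
  shows "walk s v b - walk s v a = (b - a) *\<^sub>R v (card {k. 1 \<le> k \<and> s k < b})"
proof -
  define C where "C = card {k. 1 \<le> k \<and> s k < b}"
  have "{k. 1 \<le> k \<and> s k < b} = {1..C}" unfolding C_def by (rule points_before_eq)
  then have C: "1 \<le> k \<and> s k < b \<longleftrightarrow> 1 \<le> k \<and> k \<le> C" for k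
    unfolding set_eq_iff mem_Collect_eq atLeastAtMost_iff by blast
  obtain L where L: "b < s L" using ex_late_jump by blast
  have before: "s k \<le> a" if "k \<le> C" for k
    using C[of k] no[of k] that ab by (cases "k = 0") (auto simp: s_zero)
  have after: "b \<le> s k" if "C < k" for k using C[of k] that by auto
  have "C < L" using before[of L] ab L by (meson le_less_trans not_le)
  have "walk s v b - walk s v a
     = (\<Sum>k<L. ((min b (s (Suc k)) - min b (s k)) - (min a (s (Suc k)) - min a (s k))) *\<^sub>R v k)"
    using ab L by (simp add: walk_eq_sum[of _ L] sum_subtractf scaleR_diff_left)
  also have "\<dots> = (\<Sum>k<L. (if k = C then (b - a) *\<^sub>R v k else 0))"
  proof (rule sum.cong[OF refl])
    fix k
    consider "k < C" | "k = C" | "C < k" by linarith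
    then show "((min b (s (Suc k)) - min b (s k)) - (min a (s (Suc k)) - min a (s k))) *\<^sub>R v k
       = (if k = C then (b - a) *\<^sub>R v k else 0)"
    proof cases
      case 1
      then have "s k \<le> a" "s (Suc k) \<le> a" using before by auto
      then show ?thesis using 1 ab by simp
    next
      case 2
      then have "s k \<le> a" "b \<le> s (Suc k)" using before after by auto
      then show ?thesis using 2 ab by simp
    next
      case 3
      then have "b \<le> s k" "b \<le> s (Suc k)" using after by auto
      then show ?thesis using 3 ab by simp
    qed
  qed
  also have "\<dots> = (b - a) *\<^sub>R v C" using \<open>C < L\<close> by (simp add: sum.delta)
  finally show ?thesis unfolding C_def .
qed

text \<open>
  The walk is the integral of its velocity, and the right-endpoint Riemann sum is exact on cells
  without jumps. On every other cell the error is at most twice the length of the cell, and there are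
  at most as many such cells as jumps.
\<close>

lemma walk_riemann_sum:
  fixes v :: "nat \<Rightarrow> real ^ 'd"
  assumes \<delta>: "0 \<le> \<delta>" and v: "\<And>k. \<bar>v k $ a\<bar> \<le> 1"
  shows "\<bar>walk s v (real m * \<delta>) $ a - \<delta> * (\<Sum>j<m. v (card {k. 1 \<le> k \<and> s k < real (Suc j) * \<delta>}) $ a)\<bar>
    \<le> 2 * \<delta> * real (card {k. 1 \<le> k \<and> s k < real m * \<delta>})"
proof (induction m)
  case (Suc m)
  let ?P = "\<lambda>b. {k. 1 \<le> k \<and> s k < b}"
  define t t' where "t = real m * \<delta>" and "t' = real (Suc m) * \<delta>"
  have tt: "0 \<le> t" "t \<le> t'" "t' - t = \<delta>" using \<delta> by (auto simp: t_def t'_def algebra_simps)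
  have fin: "finite (?P b)" for b by (rule finite_subset[OF _ s_finite[of b]]) auto
  have sub: "?P t \<subseteq> ?P t'" using tt by auto
  have "\<bar>walk s v t' $ a - walk s v t $ a - \<delta> * v (card (?P t')) $ a\<bar>
     \<le> 2 * \<delta> * (real (card (?P t')) - real (card (?P t)))"
  proof (cases "\<exists>k\<ge>1. s k \<in> {t..<t'}")
    case True
    then obtain k where "k \<in> ?P t'" "k \<notin> ?P t" by (auto simp: not_less)
    then have "?P t \<noteq> ?P t'" by blast
    then have "card (?P t) < card (?P t')" using sub fin by (intro psubset_card_mono) auto
    then have "2 * \<delta> * 1 \<le> 2 * \<delta> * (real (card (?P t')) - real (card (?P t)))"
      using \<delta> by (intro mult_left_mono) auto
    moreover have "\<bar>walk s v t' $ a - walk s v t $ a\<bar> \<le> \<delta>"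
      using walk_component_lipschitz[OF tt(1,2) v] tt(3) by simp
    moreover have "\<bar>\<delta> * v (card (?P t')) $ a\<bar> \<le> \<delta>"
      using v[of "card (?P t')"] \<delta> by (simp add: abs_mult mult_left_le)
    ultimately show ?thesis by linarith
  next
    case False
    then have "walk s v t' - walk s v t = (t' - t) *\<^sub>R v (card (?P t'))"
      by (intro walk_increment_between_jumps tt) auto
    then have "walk s v t' $ a - walk s v t $ a = \<delta> * v (card (?P t')) $ a"
      using tt(3) by (simp add: vec_eq_iff)
    moreover have "card (?P t) \<le> card (?P t')" using sub fin by (intro card_mono)
    ultimately show ?thesis using \<delta> by simp
  qed
  moreover have "(\<Sum>j<Suc m. v (card (?P (real (Suc j) * \<delta>))) $ a)
     = (\<Sum>j<m. v (card (?P (real (Suc j) * \<delta>))) $ a) + v (card (?P t')) $ a"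
    by (simp only: sum.lessThan_Suc t'_def)
  ultimately show ?case
    using Suc.IH unfolding t'_def[symmetric] t_def[symmetric] by (simp only: distrib_left right_diff_distrib)
qed (use \<delta> in \<open>simp add: walk_zero\<close>)

lemma card_points_before_grid:
  assumes "0 \<le> \<delta>"
  shows "card {k. 1 \<le> k \<and> s k < real m * \<delta>}
     = (\<Sum>j<m. card {k. 1 \<le> k \<and> s k \<in> {real j * \<delta>..<real (Suc j) * \<delta>}})"
proof (induction m)
  case 0
  have none: "{k. 1 \<le> k \<and> s k < real 0 * \<delta>} = {}" using s_nonneg by (auto simp: not_less)
  show ?case unfolding none by simp
next
  case (Suc m)
  have fin: "finite {k. 1 \<le> k \<and> s k < b}" for b by (rule finite_subset[OF _ s_finite[of b]]) auto
  have "real m * \<delta> \<le> real (Suc m) * \<delta>" using assms by (simp add: algebra_simps)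
  then have "{k. 1 \<le> k \<and> s k < real (Suc m) * \<delta>}
     = {k. 1 \<le> k \<and> s k < real m * \<delta>} \<union> {k. 1 \<le> k \<and> s k \<in> {real m * \<delta>..<real (Suc m) * \<delta>}}"
    by auto
  also have "card \<dots> = card {k. 1 \<le> k \<and> s k < real m * \<delta>}
      + card {k. 1 \<le> k \<and> s k \<in> {real m * \<delta>..<real (Suc m) * \<delta>}}"
    by (intro card_Un_disjoint fin finite_subset[OF _ fin[of "real (Suc m) * \<delta>"]]) auto
  finally show ?case by (simp only: Suc.IH sum.lessThan_Suc)
qed

end

section \<open>Reversals of direction\<close>

lemma finite_signed_unit_vectors: "finite (signed_unit_vectors :: (real ^ 'd) set)"
  and axis_in_signed_unit_vectors: "axis i 1 \<in> signed_unit_vectors" "- axis i 1 \<in> signed_unit_vectors"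
  by (auto simp: signed_unit_vectors_def)

context orthogonal_walk
begin

definition direction_prob :: real where
  "direction_prob = 1 / real (card (signed_unit_vectors :: (real ^ 'd) set))"

lemma direction_prob_bounds: "0 < direction_prob" "direction_prob \<le> 1"
proof -
  have "0 < card (signed_unit_vectors :: (real ^ 'd) set)"
    using axis_in_signed_unit_vectors(1) finite_signed_unit_vectors by (subst card_gt_0_iff) blast
  then show "0 < direction_prob" "direction_prob \<le> 1" by (auto simp: direction_prob_def)
qed

lemma f_measurable [measurable]: "f k \<in> borel_measurable M"
  using directions_indep by (auto simp: indep_vars_def)

lemma emeasure_direction:
  assumes "A \<in> sets borel"
  shows "emeasure M {\<omega> \<in> space M. f k \<omega> \<in> A}
    = emeasure (pmf_of_set (signed_unit_vectors :: (real ^ 'd) set)) A"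
proof -
  have "emeasure M {\<omega> \<in> space M. f k \<omega> \<in> A} = emeasure (distr M borel (f k)) A"
    using assms by (subst emeasure_distr) (auto simp: vimage_def Int_def conj_commute intro!: arg_cong[where f = "emeasure M"])
  also have "\<dots> = emeasure (pmf_of_set (signed_unit_vectors :: (real ^ 'd) set)) A"
    unfolding directions_uniform using assms by (subst emeasure_distr) auto
  finally show ?thesis .
qed

lemma prob_direction_eq:
  assumes "v \<in> signed_unit_vectors"
  shows "prob {\<omega> \<in> space M. f k \<omega> = v} = direction_prob"
proof -
  have "emeasure M {\<omega> \<in> space M. f k \<omega> = v} = emeasure (pmf_of_set (signed_unit_vectors :: (real ^ 'd) set)) {v}"
    using emeasure_direction[of "{v}" k] by simp
  also have "\<dots> = ennreal direction_prob"
    using assms finite_signed_unit_vectors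
    by (subst emeasure_pmf_single, subst pmf_of_set) (auto simp: direction_prob_def)
  finally show ?thesis
    using direction_prob_bounds by (simp add: emeasure_eq_measure)
qed

lemma AE_direction_component_le_1: "AE \<omega> in M. \<forall>k a. \<bar>f k \<omega> $ a\<bar> \<le> 1"
proof -
  have "AE \<omega> in M. f k \<omega> \<in> signed_unit_vectors" for k
  proof -
    have [measurable]: "(signed_unit_vectors :: (real ^ 'd) set) \<in> sets borel"
      by (intro borel_closed finite_imp_closed finite_signed_unit_vectors)
    have "emeasure (pmf_of_set (signed_unit_vectors :: (real ^ 'd) set)) signed_unit_vectors = 1"
      using finite_signed_unit_vectors axis_in_signed_unit_vectors(1)
      by (subst emeasure_pmf_of_set) (auto simp: divide_ennreal card_gt_0_iff ennreal_of_nat_eq_real_of_nat)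
    then have "prob {\<omega> \<in> space M. f k \<omega> \<in> signed_unit_vectors} = 1"
      using emeasure_direction[of signed_unit_vectors k] by (simp add: emeasure_eq_measure)
    then show ?thesis by (subst (asm) prob_Collect_eq_1) auto
  qed
  then have "AE \<omega> in M. \<forall>k. f k \<omega> \<in> signed_unit_vectors" by (simp add: AE_all_countable)
  then show ?thesis
  proof eventually_elim
    case (elim \<omega>)
    show ?case
    proof (intro allI)
      fix k a
      have "f k \<omega> \<in> signed_unit_vectors" using elim by blast
      then show "\<bar>f k \<omega> $ a\<bar> \<le> 1" by (auto simp: signed_unit_vectors_def axis_def)
    qed
  qed
qed

definition reverses :: "'d \<Rightarrow> nat \<Rightarrow> 'a \<Rightarrow> bool" where
  "reverses a k \<omega> \<longleftrightarrow> f k \<omega> = axis a 1 \<and> f (Suc k) \<omega> = - axis a 1"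

lemma reverses_measurable [measurable]: "Measurable.pred M (reverses a k)"
  unfolding reverses_def[abs_def] by measurable

lemma prob_reverses: "prob {\<omega> \<in> space M. reverses a k \<omega>} = direction_prob\<^sup>2"
proof -
  let ?A = "\<lambda>j::nat. if j = k then {axis a 1 :: real ^ 'd} else {- axis a 1}"
  have "prob (\<Inter>j\<in>{k, Suc k}. f j -` ?A j \<inter> space M) = (\<Prod>j\<in>{k, Suc k}. prob (f j -` ?A j \<inter> space M))"
    by (rule indep_varsD[OF directions_indep]) auto
  also have "(\<Inter>j\<in>{k, Suc k}. f j -` ?A j \<inter> space M) = {\<omega> \<in> space M. reverses a k \<omega>}"
    by (auto simp: reverses_def)
  also have "(\<Prod>j\<in>{k, Suc k}. prob (f j -` ?A j \<inter> space M)) = direction_prob\<^sup>2"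
  proof -
    have "f k -` {axis a 1} \<inter> space M = {\<omega> \<in> space M. f k \<omega> = axis a 1}"
      "f (Suc k) -` {- axis a 1} \<inter> space M = {\<omega> \<in> space M. f (Suc k) \<omega> = - axis a 1}" by auto
    then show ?thesis by (simp add: prob_direction_eq axis_in_signed_unit_vectors power2_eq_square)
  qed
  finally show ?thesis .
qed

text \<open>
  The event of a reversal at \<open>k\<close> involves the directions \<open>k\<close> and \<open>Suc k\<close>. The index set must not
  contain neighbours, so that these pairs are disjoint and the events independent.
\<close>

lemma nn_integral_half_power_reverses:
  assumes fin: "finite K" and sep: "\<And>k l. k \<in> K \<Longrightarrow> l \<in> K \<Longrightarrow> Suc k \<noteq> l"
  shows "(\<integral>\<^sup>+\<omega>. (\<Prod>k\<in>K. ennreal (if reverses a k \<omega> then 1/2 else 1)) \<partial>M)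
    = ennreal ((1 - direction_prob\<^sup>2 / 2) ^ card K)"
proof -
  let ?h = "\<lambda>k (x :: nat \<Rightarrow> real ^ 'd). ennreal (if x k = axis a 1 \<and> x (Suc k) = - axis a 1 then 1/2 else 1)"
  have "indep_vars (\<lambda>k. PiM {k, Suc k} (\<lambda>_. borel)) (\<lambda>k \<omega>. restrict (\<lambda>i. f i \<omega>) {k, Suc k}) K"
    by (rule indep_vars_restrict[OF directions_indep]) (use sep in \<open>auto simp: disjoint_family_on_def\<close>)
  then have "indep_vars (\<lambda>_. borel) (\<lambda>k \<omega>. ?h k (restrict (\<lambda>i. f i \<omega>) {k, Suc k})) K"
  proof (rule indep_vars_compose2)
    fix k
    have [measurable]: "(\<lambda>x. x k) \<in> borel_measurable (PiM {k, Suc k} (\<lambda>_. borel :: (real ^ 'd) measure))"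
      "(\<lambda>x. x (Suc k)) \<in> borel_measurable (PiM {k, Suc k} (\<lambda>_. borel :: (real ^ 'd) measure))"
      by (auto intro: measurable_component_singleton)
    show "?h k \<in> borel_measurable (PiM {k, Suc k} (\<lambda>_. borel))" by measurable
  qed
  then have indep: "indep_vars (\<lambda>_. borel) (\<lambda>k \<omega>. ennreal (if reverses a k \<omega> then 1/2 else 1)) K"
    by (simp add: reverses_def)
  have single: "(\<integral>\<^sup>+\<omega>. ennreal (if reverses a k \<omega> then 1/2 else 1) \<partial>M) = ennreal (1 - direction_prob\<^sup>2 / 2)" for k
  proof -
    have "(\<integral>\<^sup>+\<omega>. ennreal (if reverses a k \<omega> then 1/2 else 1) \<partial>M)
       = ennreal (\<integral>\<omega>. (if reverses a k \<omega> then 1/2 else 1) \<partial>M)"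
      by (intro nn_integral_eq_integral integrable_const_bound[where B = 1]) auto
    also have "(\<integral>\<omega>. (if reverses a k \<omega> then 1/2 else 1 :: real) \<partial>M)
       = (\<integral>\<omega>. 1 - 1/2 * indicator {\<omega> \<in> space M. reverses a k \<omega>} \<omega> \<partial>M)"
      by (intro Bochner_Integration.integral_cong) auto
    also have "\<dots> = 1 - direction_prob\<^sup>2 / 2"
    proof -
      have "integrable M (indicator {\<omega> \<in> space M. reverses a k \<omega>} :: 'a \<Rightarrow> real)"
        by (rule integrable_real_indicator) (auto simp: less_top[symmetric])
      then show ?thesis by (simp add: prob_space prob_reverses)
    qed
    finally show ?thesis .
  qed
  have "direction_prob\<^sup>2 \<le> 1" using direction_prob_bounds by (simp add: power_le_one)
  then show ?thesis
    by (subst indep_vars_nn_integral[OF fin indep]) (simp_all add: single ennreal_power)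
qed

definition reversal_decay :: real where
  "reversal_decay = sqrt (1 - direction_prob\<^sup>2 / 2)"

lemma reversal_decay_bounds: "0 < reversal_decay" "reversal_decay < 1"
proof -
  have "direction_prob\<^sup>2 \<le> 1" "0 < direction_prob\<^sup>2"
    using direction_prob_bounds by (auto simp: power_le_one)
  then show "0 < reversal_decay" "reversal_decay < 1" by (auto simp: reversal_decay_def real_sqrt_lt_1_iff)
qed

text \<open>
  Markov's inequality for \<open>2\<close> to the power of minus the number of reversals. Restricting to the
  indices of the more frequent parity makes the pairs of directions disjoint and costs at most half
  of the indices; the square root in \<open>reversal_decay\<close> accounts for that loss.
\<close>

lemma emeasure_few_reversals_le:
  assumes fin: "finite K"
  shows "emeasure M {\<omega> \<in> space M. card {k \<in> K. reverses a k \<omega>} < n} \<le> ennreal (2 ^ n * reversal_decay ^ card K)"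
proof -
  obtain K' where K': "K' \<subseteq> K" "card K \<le> 2 * card K'" "\<And>k l. k \<in> K' \<Longrightarrow> l \<in> K' \<Longrightarrow> Suc k \<noteq> l"
  proof -
    have "K = {k \<in> K. even k} \<union> {k \<in> K. odd k}" by auto
    then have "card K \<le> card {k \<in> K. even k} + card {k \<in> K. odd k}" by (metis card_Un_le)
    then consider "card K \<le> 2 * card {k \<in> K. even k}" | "card K \<le> 2 * card {k \<in> K. odd k}" by linarith
    then show ?thesis
    proof cases
      case 1 show ?thesis by (rule that[of "{k \<in> K. even k}"]) (use 1 in auto)
    next
      case 2 show ?thesis by (rule that[of "{k \<in> K. odd k}"]) (use 2 in auto)
    qed
  qed
  have finK': "finite K'" using K' fin finite_subset by blast
  let ?X = "\<lambda>\<omega>. \<Prod>k\<in>K'. ennreal (if reverses a k \<omega> then 1/2 else 1)"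
  have le: "indicator {\<omega> \<in> space M. card {k \<in> K. reverses a k \<omega>} < n} \<omega> \<le> ennreal (2 ^ n) * ?X \<omega>" for \<omega>
  proof (cases "card {k \<in> K. reverses a k \<omega>} < n")
    case True
    have "card {k \<in> K'. reverses a k \<omega>} \<le> card {k \<in> K. reverses a k \<omega>}"
      using K' fin by (intro card_mono) auto
    then have le_n: "card {k \<in> K'. reverses a k \<omega>} \<le> n" using True by simp
    have "?X \<omega> = ennreal (\<Prod>k\<in>K'. if reverses a k \<omega> then 1/2 else 1)" by (rule prod_ennreal) auto
    also have "(\<Prod>k\<in>K'. if reverses a k \<omega> then 1/2 else 1 :: real) = (1/2) ^ card {k \<in> K'. reverses a k \<omega>}"
      using finK' by (subst prod.If_cases) (auto simp: Int_def)
    finally have "ennreal (2 ^ n) * ?X \<omega> = ennreal (2 ^ n * (1/2) ^ card {k \<in> K'. reverses a k \<omega>})"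
      by (simp add: ennreal_mult)
    moreover have "(1::real) \<le> 2 ^ n * (1/2) ^ card {k \<in> K'. reverses a k \<omega>}"
      using power_increasing[OF le_n, of "2::real"] by (simp add: power_one_over field_simps)
    ultimately have "1 \<le> ennreal (2 ^ n) * ?X \<omega>" by (simp only: ennreal_ge_1)
    then show ?thesis by (simp add: indicator_def)
  qed simp
  have "emeasure M {\<omega> \<in> space M. card {k \<in> K. reverses a k \<omega>} < n}
     = (\<integral>\<^sup>+\<omega>. indicator {\<omega> \<in> space M. card {k \<in> K. reverses a k \<omega>} < n} \<omega> \<partial>M)"
  proof (rule nn_integral_indicator[symmetric])
    have "card {k \<in> K. reverses a k \<omega>} = (\<Sum>k\<in>K. if reverses a k \<omega> then 1 else 0)" for \<omega>
      using fin by (simp add: sum.If_cases Int_def)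
    then show "{\<omega> \<in> space M. card {k \<in> K. reverses a k \<omega>} < n} \<in> events" by simp
  qed
  also have "\<dots> \<le> (\<integral>\<^sup>+\<omega>. ennreal (2 ^ n) * ?X \<omega> \<partial>M)" by (intro nn_integral_mono le)
  also have "\<dots> = ennreal (2 ^ n) * ennreal ((1 - direction_prob\<^sup>2 / 2) ^ card K')"
    using K' finK' by (subst nn_integral_cmult) (auto simp: nn_integral_half_power_reverses)
  also have "(1 - direction_prob\<^sup>2 / 2) ^ card K' = reversal_decay ^ (2 * card K')"
  proof -
    have "direction_prob\<^sup>2 \<le> 1" using direction_prob_bounds by (simp add: power_le_one)
    then show ?thesis by (simp add: reversal_decay_def power_mult)
  qed
  also have "ennreal (2 ^ n) * ennreal (reversal_decay ^ (2 * card K')) \<le> ennreal (2 ^ n) * ennreal (reversal_decay ^ card K)"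
    using K'(2) reversal_decay_bounds by (intro mult_left_mono ennreal_leI power_decreasing) auto
  also have "\<dots> = ennreal (2 ^ n * reversal_decay ^ card K)"
    using reversal_decay_bounds by (simp add: ennreal_mult)
  finally show ?thesis .
qed

end

section \<open>The joint law of the cell counts\<close>

text \<open>
  Fubini for a discrete variable \<open>C\<close> with law \<open>p\<close>, in a form that asks for the independence of
  each level set of \<open>C\<close> from the event attached to that level only.
\<close>

lemma (in prob_space) emeasure_independent_discrete_le:
  assumes X: "countable X" "\<And>\<omega>. \<omega> \<in> space M \<Longrightarrow> C \<omega> \<in> X"
    and C: "\<And>x. x \<in> X \<Longrightarrow> {\<omega> \<in> space M. C \<omega> = x} \<in> events"
    and law: "\<And>x. x \<in> X \<Longrightarrow> prob {\<omega> \<in> space M. C \<omega> = x} = pmf p x"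
    and Q: "\<And>x. x \<in> X \<Longrightarrow> {\<omega> \<in> space M. Q x \<omega>} \<in> events"
    and indep: "\<And>x. x \<in> X \<Longrightarrow> prob ({\<omega> \<in> space M. C \<omega> = x} \<inter> {\<omega> \<in> space M. Q x \<omega>})
      = prob {\<omega> \<in> space M. C \<omega> = x} * prob {\<omega> \<in> space M. Q x \<omega>}"
  shows "{\<omega> \<in> space M. Q (C \<omega>) \<omega>} \<in> events"
    and "emeasure M {\<omega> \<in> space M. Q (C \<omega>) \<omega>} \<le> (\<integral>\<^sup>+x. emeasure M {\<omega> \<in> space M. Q x \<omega>} \<partial>p)"
proof -
  let ?E = "\<lambda>x. {\<omega> \<in> space M. C \<omega> = x} \<inter> {\<omega> \<in> space M. Q x \<omega>}"
  have eq: "{\<omega> \<in> space M. Q (C \<omega>) \<omega>} = (\<Union>x\<in>X. ?E x)" using X(2) by auto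
  have E: "?E x \<in> events" if "x \<in> X" for x using C[OF that] Q[OF that] by (rule sets.Int)
  show "{\<omega> \<in> space M. Q (C \<omega>) \<omega>} \<in> events"
    unfolding eq by (rule sets.countable_UN'[OF X(1)]) (use E in auto)
  have "emeasure M {\<omega> \<in> space M. Q (C \<omega>) \<omega>} = (\<integral>\<^sup>+x. emeasure M (?E x) \<partial>count_space X)"
    unfolding eq by (rule emeasure_UN_countable[OF E X(1)]) (auto simp: disjoint_family_on_def)
  also have "\<dots> = (\<integral>\<^sup>+x. ennreal (pmf p x) * emeasure M {\<omega> \<in> space M. Q x \<omega>} \<partial>count_space X)"
    by (intro nn_integral_cong) (simp add: emeasure_eq_measure indep law flip: ennreal_mult)
  also have "\<dots> \<le> (\<integral>\<^sup>+x. ennreal (pmf p x) * emeasure M {\<omega> \<in> space M. Q x \<omega>} \<partial>count_space UNIV)"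
    by (subst nn_integral_count_space_indicator) (auto intro!: nn_integral_mono simp: indicator_def)
  also have "\<dots> = (\<integral>\<^sup>+x. emeasure M {\<omega> \<in> space M. Q x \<omega>} \<partial>p)"
    by (rule nn_integral_measure_pmf[symmetric])
  finally show "emeasure M {\<omega> \<in> space M. Q (C \<omega>) \<omega>} \<le> (\<integral>\<^sup>+x. emeasure M {\<omega> \<in> space M. Q x \<omega>} \<partial>p)" .
qed

text \<open>
  The cells are half-open to the right, so that time \<open>0\<close> needs no special treatment.
\<close>

definition time_cell :: "real \<Rightarrow> nat \<Rightarrow> real set" where
  "time_cell \<delta> j = {real j * \<delta>..<real (Suc j) * \<delta>}"

lemma disjoint_time_cells:
  assumes "0 < \<delta>"
  shows "disjoint_family (time_cell \<delta>)"
proof -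
  have "time_cell \<delta> i \<inter> time_cell \<delta> j = {}" if "i < j" for i j
  proof -
    have "real (Suc i) * \<delta> \<le> real j * \<delta>" using that assms by (intro mult_right_mono) auto
    then show ?thesis by (auto simp: time_cell_def)
  qed
  then show ?thesis unfolding disjoint_family_on_def by (metis Int_commute nat_neq_iff)
qed

lemma time_cell_subset: "0 < \<delta> \<Longrightarrow> time_cell \<delta> j \<in> sets borel \<and> bounded (time_cell \<delta> j) \<and> time_cell \<delta> j \<subseteq> {0..}"
  by (auto simp: time_cell_def zero_le_mult_iff intro: order_trans[rotated] bounded_subset[OF bounded_closed_interval])

context orthogonal_walk
begin

definition cell_mass :: "real \<Rightarrow> nat \<Rightarrow> real" where
  "cell_mass \<delta> j = (LINT t:time_cell \<delta> j|lborel. r t)"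

definition window_counts :: "real \<Rightarrow> nat \<Rightarrow> nat \<Rightarrow> 'a \<Rightarrow> nat \<Rightarrow> nat \<Rightarrow> nat" where
  "window_counts \<delta> L B \<omega> i l =
    (if i < L \<and> l < B then point_count \<tau> (time_cell \<delta> (i * B + l)) \<omega> else 0)"

definition window_counts_law :: "real \<Rightarrow> nat \<Rightarrow> nat \<Rightarrow> (nat \<Rightarrow> nat \<Rightarrow> nat) pmf" where
  "window_counts_law \<delta> L B = Pi_pmf {..<L} (\<lambda>_. 0) (\<lambda>i. Pi_pmf {..<B} 0 (\<lambda>l. poisson_pmf (cell_mass \<delta> (i * B + l))))"

lemma point_count_event:
  assumes "A \<in> sets borel"
  shows "{\<omega> \<in> space M. point_count \<tau> A \<omega> = n}
     \<in> sets (vimage_algebra (space M) (\<lambda>\<omega> k. \<tau> k \<omega>) (\<Pi>\<^sub>M k\<in>UNIV. borel))"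
proof -
  let ?P = "\<Pi>\<^sub>M k\<in>(UNIV :: nat set). (borel :: real measure)"
  have [measurable]: "(\<lambda>y. y k) \<in> borel_measurable ?P" for k
    by (rule measurable_component_singleton) simp
  have "(\<lambda>y. card {k. 1 \<le> k \<and> y k \<in> A}) \<in> measurable ?P (count_space UNIV)"
    using assms by measurable
  then have "{y \<in> space ?P. card {k. 1 \<le> k \<and> y k \<in> A} = n} \<in> sets ?P" by measurable
  then have "(\<lambda>\<omega> k. \<tau> k \<omega>) -` {y \<in> space ?P. card {k. 1 \<le> k \<and> y k \<in> A} = n} \<inter> space M
     \<in> sets (vimage_algebra (space M) (\<lambda>\<omega> k. \<tau> k \<omega>) ?P)" by (rule in_vimage_algebra)
  also have "(\<lambda>\<omega> k. \<tau> k \<omega>) -` {y \<in> space ?P. card {k. 1 \<le> k \<and> y k \<in> A} = n} \<inter> space M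
     = {\<omega> \<in> space M. point_count \<tau> A \<omega> = n}"
    by (auto simp: point_count_def space_PiM)
  finally show ?thesis .
qed

lemma points_algebra_subset:
  "sets (vimage_algebra (space M) (\<lambda>\<omega> k. \<tau> k \<omega>) (\<Pi>\<^sub>M k\<in>UNIV. borel)) \<subseteq> events"
  by (rule indep_setD_ev1[OF directions_indep_points])

text \<open>
  The counts of disjoint cells are independent Poisson variables. Membership in the sigma-algebra
  generated by the points, rather than mere measurability, is what gives independence from the
  directions later.
\<close>

lemma prob_window_counts:
  assumes pos: "0 < \<delta>" "0 < L" "0 < B" and mass: "\<And>j. j < L * B \<Longrightarrow> 0 < cell_mass \<delta> j"
    and x: "x \<in> set_pmf (window_counts_law \<delta> L B)"
  shows "{\<omega> \<in> space M. window_counts \<delta> L B \<omega> = x}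
      \<in> sets (vimage_algebra (space M) (\<lambda>\<omega> k. \<tau> k \<omega>) (\<Pi>\<^sub>M k\<in>UNIV. borel))" (is "?E \<in> ?A")
    and "prob {\<omega> \<in> space M. window_counts \<delta> L B \<omega> = x} = pmf (window_counts_law \<delta> L B) x"
proof -
  have x0: "x i l = 0" if "\<not> (i < L \<and> l < B)" for i l
  proof -
    have x1: "x \<in> PiE_dflt {..<L} (\<lambda>_. 0) (set_pmf \<circ> (\<lambda>i. Pi_pmf {..<B} 0 (\<lambda>l. poisson_pmf (cell_mass \<delta> (i * B + l)))))"
      by (rule subsetD[OF set_Pi_pmf_subset'[OF finite_lessThan] x[unfolded window_counts_law_def]])
    show ?thesis
    proof (cases "i < L")
      case True
      then have "x i \<in> set_pmf (Pi_pmf {..<B} 0 (\<lambda>l. poisson_pmf (cell_mass \<delta> (i * B + l))))"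
        using x1 by (auto simp: PiE_dflt_def)
      then have "x i \<in> {f. \<forall>l. l \<notin> {..<B} \<longrightarrow> f l = 0}" by (rule subsetD[OF set_Pi_pmf_subset[OF finite_lessThan]])
      then show ?thesis using True that by auto
    next
      case False
      then show ?thesis using x1 by (auto simp: PiE_dflt_def)
    qed
  qed
  let ?y = "\<lambda>j. x (j div B) (j mod B)"
  have idx: "i * B + l < L * B" if "i < L" "l < B" for i l
  proof -
    have "i * B + l < Suc i * B" using that by simp
    also have "\<dots> \<le> L * B" using that by (intro mult_le_mono1) simp
    finally show ?thesis .
  qed
  have E: "?E = (\<Inter>j\<in>{..<L * B}. point_count \<tau> (time_cell \<delta> j) -` {?y j} \<inter> space M)" (is "_ = ?I")
  proof (intro equalityI subsetI)
    fix \<omega> assume \<omega>: "\<omega> \<in> ?E"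
    show "\<omega> \<in> ?I"
    proof
      fix j assume "j \<in> {..<L * B}"
      then have j: "j div B < L" "j mod B < B" using pos by (auto simp: less_mult_imp_div_less)
      have "window_counts \<delta> L B \<omega> (j div B) (j mod B) = ?y j" using \<omega> by auto
      then show "\<omega> \<in> point_count \<tau> (time_cell \<delta> j) -` {?y j} \<inter> space M"
        using j \<omega> by (simp add: window_counts_def)
    qed
  next
    fix \<omega> assume \<omega>: "\<omega> \<in> ?I"
    have "L * B > 0" using pos by simp
    then have "0 \<in> {..<L * B}" by simp
    then have "\<omega> \<in> space M" using \<omega> by blast
    moreover have "window_counts \<delta> L B \<omega> i l = x i l" for i l
    proof (cases "i < L \<and> l < B")
      case True
      then have "\<omega> \<in> point_count \<tau> (time_cell \<delta> (i * B + l)) -` {?y (i * B + l)}" using \<omega> idx by blast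
      moreover have "?y (i * B + l) = x i l" using True by simp
      ultimately show ?thesis using True by (simp add: window_counts_def)
    next
      case False
      then show ?thesis using x0[OF False] by (auto simp: window_counts_def)
    qed
    ultimately show "\<omega> \<in> ?E" by auto
  qed
  have ev: "point_count \<tau> (time_cell \<delta> j) -` {n} \<inter> space M \<in> ?A" for j n
    using point_count_event[of "time_cell \<delta> j" n] time_cell_subset[OF pos(1), of j]
    by (simp add: vimage_def Int_def conj_commute)
  show "?E \<in> ?A"
    unfolding E using pos by (intro sets.finite_INT ev) (simp_all add: lessThan_empty_iff)
  have "prob ?E = (\<Prod>j\<in>{..<L * B}. prob (point_count \<tau> (time_cell \<delta> j) -` {?y j} \<inter> space M))"
    unfolding E
  proof (rule indep_varsD_finite)
    show "indep_vars (\<lambda>_. count_space UNIV) (\<lambda>j. point_count \<tau> (time_cell \<delta> j)) {..<L * B}"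
      using time_cell_subset[OF pos(1)] disjoint_time_cells[OF pos(1)]
      by (intro counts_indep) (auto simp: disjoint_family_on_def)
  qed (use pos in \<open>auto simp: lessThan_empty_iff\<close>)
  also have "\<dots> = (\<Prod>j\<in>{..<L * B}. pmf (poisson_pmf (cell_mass \<delta> j)) (?y j))"
  proof (rule prod.cong[OF refl])
    fix j assume j: "j \<in> {..<L * B}"
    have "point_count \<tau> (time_cell \<delta> j) -` {?y j} \<inter> space M
       = {\<omega> \<in> space M. point_count \<tau> (time_cell \<delta> j) \<omega> = ?y j}" by auto
    then show "prob (point_count \<tau> (time_cell \<delta> j) -` {?y j} \<inter> space M) = pmf (poisson_pmf (cell_mass \<delta> j)) (?y j)"
      using j mass[of j] time_cell_subset[OF pos(1), of j] by (simp add: counts_poisson cell_mass_def)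
  qed
  also have "\<dots> = (\<Prod>i<L. \<Prod>l<B. pmf (poisson_pmf (cell_mass \<delta> (i * B + l))) (x i l))"
  proof -
    have "(\<Prod>j\<in>{..<L * B}. pmf (poisson_pmf (cell_mass \<delta> j)) (?y j))
       = (\<Prod>i<L. \<Prod>j\<in>{i * B..<i * B + B}. pmf (poisson_pmf (cell_mass \<delta> j)) (?y j))"
      by (rule prod.nat_group[symmetric])
    also have "\<dots> = (\<Prod>i<L. \<Prod>l<B. pmf (poisson_pmf (cell_mass \<delta> (i * B + l))) (x i l))"
    proof (rule prod.cong[OF refl])
      fix i
      show "(\<Prod>j\<in>{i * B..<i * B + B}. pmf (poisson_pmf (cell_mass \<delta> j)) (?y j))
         = (\<Prod>l<B. pmf (poisson_pmf (cell_mass \<delta> (i * B + l))) (x i l))"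
      proof (rule prod.reindex_bij_witness[of _ "\<lambda>l. i * B + l" "\<lambda>j. j - i * B"])
        fix j assume j: "j \<in> {i * B..<i * B + B}"
        then have "j div B = i" by (intro div_nat_eqI) (auto simp: mult.commute)
        moreover from this have "j mod B = j - i * B" by (metis minus_div_mult_eq_mod)
        ultimately show "pmf (poisson_pmf (cell_mass \<delta> (i * B + (j - i * B)))) (x i (j - i * B))
          = pmf (poisson_pmf (cell_mass \<delta> j)) (?y j)" using j by simp
      qed auto
    qed
    finally show ?thesis .
  qed
  also have "\<dots> = pmf (window_counts_law \<delta> L B) x"
    unfolding window_counts_law_def using x0
    by (subst pmf_Pi', simp, simp add: fun_eq_iff) (intro prod.cong refl pmf_Pi'[symmetric], auto)
  finally show "prob ?E = pmf (window_counts_law \<delta> L B) x" .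
qed

text \<open>
  Integrating over an independent copy of the counts reduces probabilities of events about counts
  and directions to an explicit product law for the counts.
\<close>

lemma window_counts_directions_le:
  assumes pos: "0 < \<delta>" "0 < L" "0 < B" and mass: "\<And>j. j < L * B \<Longrightarrow> 0 < cell_mass \<delta> j"
    and R: "\<And>x. {y \<in> space (\<Pi>\<^sub>M k\<in>UNIV. borel). R x y} \<in> sets (\<Pi>\<^sub>M k\<in>UNIV. borel)"
  shows "{\<omega> \<in> space M. R (window_counts \<delta> L B \<omega>) (\<lambda>k. f k \<omega>)} \<in> events"
    and "emeasure M {\<omega> \<in> space M. R (window_counts \<delta> L B \<omega>) (\<lambda>k. f k \<omega>)}
      \<le> (\<integral>\<^sup>+x. emeasure M {\<omega> \<in> space M. R x (\<lambda>k. f k \<omega>)} \<partial>window_counts_law \<delta> L B)"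
proof -
  let ?X = "set_pmf (window_counts_law \<delta> L B)"
  let ?F = "sets (vimage_algebra (space M) (\<lambda>\<omega> k. f k \<omega>) (\<Pi>\<^sub>M k\<in>UNIV. borel))"
  have mem: "window_counts \<delta> L B \<omega> \<in> ?X" for \<omega>
  proof -
    have "set_pmf (poisson_pmf (cell_mass \<delta> (i * B + l))) = UNIV" if "i < L" "l < B" for i l
    proof -
      have "i * B + l < Suc i * B" using that by simp
      also have "\<dots> \<le> L * B" using that by (intro mult_le_mono1) simp
      finally show ?thesis using mass by simp
    qed
    then show ?thesis
      unfolding window_counts_law_def by (auto simp: set_Pi_pmf PiE_dflt_def window_counts_def fun_eq_iff)
  qed
  have ev: "{\<omega> \<in> space M. R x (\<lambda>k. f k \<omega>)} \<in> ?F" for x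
  proof -
    have "(\<lambda>\<omega> k. f k \<omega>) -` {y \<in> space (\<Pi>\<^sub>M k\<in>UNIV. borel). R x y} \<inter> space M \<in> ?F"
      by (rule in_vimage_algebra[OF R])
    moreover have "(\<lambda>\<omega> k. f k \<omega>) -` {y \<in> space (\<Pi>\<^sub>M k\<in>UNIV. borel). R x y} \<inter> space M
      = {\<omega> \<in> space M. R x (\<lambda>k. f k \<omega>)}" by (auto simp: space_PiM)
    ultimately show ?thesis by simp
  qed
  have F: "?F \<subseteq> events" by (rule indep_setD_ev2[OF directions_indep_points])
  note E = prob_window_counts[OF pos mass]
  show "{\<omega> \<in> space M. R (window_counts \<delta> L B \<omega>) (\<lambda>k. f k \<omega>)} \<in> events"
    by (rule emeasure_independent_discrete_le(1)[where X = ?X and p = "window_counts_law \<delta> L B" and Q = "\<lambda>x \<omega>. R x (\<lambda>k. f k \<omega>)"])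
      (use mem E ev F points_algebra_subset indep_setD[OF directions_indep_points] in auto)
  show "emeasure M {\<omega> \<in> space M. R (window_counts \<delta> L B \<omega>) (\<lambda>k. f k \<omega>)}
      \<le> (\<integral>\<^sup>+x. emeasure M {\<omega> \<in> space M. R x (\<lambda>k. f k \<omega>)} \<partial>window_counts_law \<delta> L B)"
    by (rule emeasure_independent_discrete_le(2)[where X = ?X and Q = "\<lambda>x \<omega>. R x (\<lambda>k. f k \<omega>)"])
      (use mem E ev F points_algebra_subset indep_setD[OF directions_indep_points] in auto)
qed

end

section \<open>Small ball probability on a grid\<close>

lemma grid_sum_cong:
  assumes "\<And>i. i < L \<Longrightarrow> w i = w' i"
  shows "grid_sum L B w g = grid_sum L B w' g"
proof -
  have "points_before_window B w i = points_before_window B w' i" if "i < L" for i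
    unfolding points_before_window_def using assms that by (intro sum.cong) auto
  then show ?thesis unfolding grid_sum_def using assms by (intro sum.cong) auto
qed

lemma base_count_strict_mono:
  assumes "i < j" "\<xi> i"
  shows "base_count B \<xi> w i < base_count B \<xi> w j"
proof -
  have "base_count B \<xi> w i < base_count B \<xi> w (Suc i)" using assms(2) by (simp add: base_count_def)
  also have "\<dots> \<le> base_count B \<xi> w j"
    unfolding base_count_def using assms(1) by (intro sum_mono2) auto
  finally show ?thesis .
qed

text \<open>
  The exponential moment that controls how rarely there are few single-point windows.
\<close>

lemma nn_integral_power_card_bernoulli:
  fixes L :: nat
  assumes q: "\<And>i. i < L \<Longrightarrow> 0 \<le> q i \<and> q i \<le> 1" and y: "0 \<le> y"
  shows "(\<integral>\<^sup>+\<xi>. ennreal (y ^ card {i. i < L \<and> \<xi> i}) \<partial>Pi_pmf {..<L} False (\<lambda>i. bernoulli_pmf (q i)))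
    = ennreal (\<Prod>i<L. 1 - q i * (1 - y))"
proof -
  have eq: "ennreal (y ^ card {i. i < L \<and> \<xi> i}) = (\<Prod>i<L. ennreal (if \<xi> i then y else 1))" for \<xi>
  proof -
    have "(\<Prod>i<L. ennreal (if \<xi> i then y else 1)) = ennreal (\<Prod>i<L. if \<xi> i then y else 1)"
      using y by (intro prod_ennreal) auto
    also have "(\<Prod>i<L. if \<xi> i then y else 1) = y ^ card {i. i < L \<and> \<xi> i}"
      by (subst prod.If_cases) (auto simp: Int_def)
    finally show ?thesis by simp
  qed
  have "(\<integral>\<^sup>+\<xi>. ennreal (y ^ card {i. i < L \<and> \<xi> i}) \<partial>Pi_pmf {..<L} False (\<lambda>i. bernoulli_pmf (q i)))
     = (\<Prod>i<L. \<integral>\<^sup>+b. ennreal (if b then y else 1) \<partial>bernoulli_pmf (q i))"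
    unfolding eq by (rule nn_integral_prod_Pi_pmf[OF finite_lessThan, where f = "\<lambda>_ b. ennreal (if b then y else 1)"])
  also have "\<dots> = (\<Prod>i<L. ennreal (1 - q i * (1 - y)))"
  proof (rule prod.cong[OF refl])
    fix i assume "i \<in> {..<L}"
    then have qi: "0 \<le> q i" "q i \<le> 1" using q by auto
    then have "(\<integral>\<^sup>+b. ennreal (if b then y else 1) \<partial>bernoulli_pmf (q i)) = ennreal y * ennreal (q i) + ennreal (1 - q i)"
      by (simp add: nn_integral_bernoulli_pmf)
    also have "\<dots> = ennreal (y * q i + (1 - q i))"
      using qi y ennreal_mult[of y "q i"] ennreal_plus[of "y * q i" "1 - q i"] by (metis diff_ge_0_iff_ge mult_nonneg_nonneg)
    also have "y * q i + (1 - q i) = 1 - q i * (1 - y)" by (simp add: algebra_simps)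
    finally show "(\<integral>\<^sup>+b. ennreal (if b then y else 1) \<partial>bernoulli_pmf (q i)) = ennreal (1 - q i * (1 - y))" .
  qed
  also have "\<dots> = ennreal (\<Prod>i<L. 1 - q i * (1 - y))"
  proof (rule prod_ennreal)
    fix i assume "i \<in> {..<L}"
    then have qi: "0 \<le> q i" "q i \<le> 1" using q by auto
    have "q i * (1 - y) \<le> q i * 1" using qi y by (intro mult_left_mono) auto
    then show "0 \<le> 1 - q i * (1 - y)" using qi by simp
  qed
  finally show ?thesis .
qed

lemma (in prob_space) nn_integral_emeasure_swap_finite:
  assumes fin: "finite (set_pmf p)" and E: "\<And>u. E u \<in> events"
  shows "(\<integral>\<^sup>+u. emeasure M (E u) \<partial>measure_pmf p) = (\<integral>\<^sup>+\<omega>. emeasure (measure_pmf p) {u. \<omega> \<in> E u} \<partial>M)"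
proof -
  have "(\<integral>\<^sup>+u. emeasure M (E u) \<partial>measure_pmf p) = (\<Sum>u\<in>set_pmf p. emeasure M (E u) * ennreal (pmf p u))"
    by (rule nn_integral_measure_pmf_finite[OF fin]) simp
  also have "\<dots> = (\<Sum>u\<in>set_pmf p. \<integral>\<^sup>+\<omega>. indicator (E u) \<omega> * ennreal (pmf p u) \<partial>M)"
    using E by (intro sum.cong refl) (simp add: nn_integral_multc)
  also have "\<dots> = (\<integral>\<^sup>+\<omega>. (\<Sum>u\<in>set_pmf p. indicator (E u) \<omega> * ennreal (pmf p u)) \<partial>M)"
    using E by (intro nn_integral_sum[symmetric]) auto
  also have "\<dots> = (\<integral>\<^sup>+\<omega>. emeasure (measure_pmf p) {u. \<omega> \<in> E u} \<partial>M)"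
  proof (rule nn_integral_cong)
    fix \<omega>
    have "emeasure (measure_pmf p) {u. \<omega> \<in> E u} = (\<integral>\<^sup>+u. indicator {u. \<omega> \<in> E u} u \<partial>measure_pmf p)" by simp
    also have "\<dots> = (\<Sum>u\<in>set_pmf p. indicator {u. \<omega> \<in> E u} u * ennreal (pmf p u))"
      by (rule nn_integral_measure_pmf_finite[OF fin]) simp
    finally show "(\<Sum>u\<in>set_pmf p. indicator (E u) \<omega> * ennreal (pmf p u)) = emeasure (measure_pmf p) {u. \<omega> \<in> E u}"
      by (simp add: indicator_def)
  qed
  finally show ?thesis .
qed

definition grid_box :: "real \<Rightarrow> nat \<Rightarrow> nat \<Rightarrow> real \<Rightarrow> 'd \<Rightarrow> 'd \<Rightarrow> (nat \<Rightarrow> nat \<Rightarrow> nat) \<Rightarrow> (nat \<Rightarrow> real ^ 'd) \<Rightarrow> bool" where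
  "grid_box \<delta> L B \<rho> a b w v \<longleftrightarrow>
    \<bar>\<delta> * grid_sum L B w (\<lambda>k. v k $ a)\<bar> \<le> \<rho> \<and> \<bar>\<delta> * grid_sum L B w (\<lambda>k. v k $ b)\<bar> \<le> \<rho>"

lemma grid_box_sets:
  "{v \<in> space (\<Pi>\<^sub>M k\<in>UNIV. borel). grid_box \<delta> L B \<rho> a b w v} \<in> sets (\<Pi>\<^sub>M k\<in>(UNIV::nat set). borel)"
proof -
  have [measurable]: "(\<lambda>v. v k $ c) \<in> borel_measurable (\<Pi>\<^sub>M k\<in>(UNIV::nat set). (borel :: (real ^ 'd) measure))" for k c
    by (rule measurable_compose[OF _ borel_measurable_nth], rule measurable_component_singleton) simp
  show ?thesis unfolding grid_box_def grid_sum_def by measurable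
qed

context orthogonal_walk
begin

lemma grid_box_event: "{\<omega> \<in> space M. grid_box \<delta> L B \<rho> a b w (\<lambda>k. f k \<omega>)} \<in> events"
proof -
  have [measurable]: "(\<lambda>\<omega>. f k \<omega> $ c) \<in> borel_measurable M" for k c
    by (rule measurable_compose[OF f_measurable borel_measurable_nth])
  show ?thesis unfolding grid_box_def grid_sum_def by measurable
qed

text \<open>
  Everything about the points is fixed here, except for the positions \<open>u\<close> of the single points; the
  directions are random. Exchanging the order of integration allows the concentration bound to be
  used for fixed directions, provided that both axes see at least \<open>m\<close> reversals at the jumps given by
  single-point windows.
\<close>

lemma nn_integral_grid_box_uniform_le:
  assumes ab: "a \<noteq> b" and pos: "0 < H" "0 < m" "0 < \<delta>" "0 \<le> \<rho>"
  shows "(\<integral>\<^sup>+u. emeasure M {\<omega> \<in> space M. grid_box \<delta> L (2 * H) \<rho> a b (mixed_windows \<xi> w u) (\<lambda>k. f k \<omega>)}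
        \<partial>Pi_pmf {..<L} 0 (\<lambda>_. pmf_of_set {..<2 * H}))
    \<le> ennreal ((\<rho> / \<delta> + 1)\<^sup>2 / (real H ^ 2 * real m))
      + ennreal (2 * 2 ^ m) * ennreal (reversal_decay ^ card {i. i < L \<and> \<xi> i})"
proof -
  let ?P = "Pi_pmf {..<L} 0 (\<lambda>_. pmf_of_set {..<2 * H})"
  let ?\<kappa> = "ennreal ((\<rho> / \<delta> + 1)\<^sup>2 / (real H ^ 2 * real m))"
  define c where "c = base_count (2 * H) \<xi> w"
  define I where "I = {i. i < L \<and> \<xi> i}"
  \<comment> \<open>The directions for which the concentration bound on axis \<open>d\<close> is too weak.\<close>
  define F where "F d = {\<omega> \<in> space M. card {k \<in> c ` I. reverses d k \<omega>} < m}" for d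
  have [simp]: "finite I" by (simp add: I_def)
  \<comment> \<open>Different single-point windows contain different jumps.\<close>
  have inj: "inj_on c I"
  proof (rule inj_onI)
    fix i j assume ij: "i \<in> I" "j \<in> I" "c i = c j"
    then show "i = j"
      using base_count_strict_mono[of i j \<xi> "2 * H" w] base_count_strict_mono[of j i \<xi> "2 * H" w]
      unfolding c_def I_def by (metis (mono_tags, lifting) less_irrefl linorder_neqE_nat mem_Collect_eq)
  qed
  have F: "F d \<in> events" for d
  proof -
    have "card {k \<in> c ` I. reverses d k \<omega>} = (\<Sum>k\<in>c ` I. if reverses d k \<omega> then 1 else 0)" for \<omega>
      by (simp add: sum.If_cases Int_def)
    then show ?thesis unfolding F_def by simp
  qed
  have fin: "finite (set_pmf ?P)"
  proof (rule finite_subset[OF set_Pi_pmf_subset'[OF finite_lessThan]])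
    show "finite (PiE_dflt {..<L} 0 (set_pmf \<circ> (\<lambda>_. pmf_of_set {..<2 * H})))"
      using pos by (intro finite_PiE_dflt) (auto simp: lessThan_empty_iff)
  qed
  have "(\<integral>\<^sup>+u. emeasure M {\<omega> \<in> space M. grid_box \<delta> L (2 * H) \<rho> a b (mixed_windows \<xi> w u) (\<lambda>k. f k \<omega>)} \<partial>?P)
     = (\<integral>\<^sup>+\<omega>. emeasure ?P {u. \<omega> \<in> {\<omega> \<in> space M. grid_box \<delta> L (2 * H) \<rho> a b (mixed_windows \<xi> w u) (\<lambda>k. f k \<omega>)}} \<partial>M)"
    by (rule nn_integral_emeasure_swap_finite[OF fin grid_box_event])
  also have "\<dots> \<le> (\<integral>\<^sup>+\<omega>. ?\<kappa> + (indicator (F a) \<omega> + indicator (F b) \<omega>) \<partial>M)"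
  proof (rule nn_integral_mono)
    fix \<omega> assume \<omega>: "\<omega> \<in> space M"
    let ?E = "{u. \<omega> \<in> {\<omega> \<in> space M. grid_box \<delta> L (2 * H) \<rho> a b (mixed_windows \<xi> w u) (\<lambda>k. f k \<omega>)}}"
    define T where "T d = {i \<in> I. reverses d (c i) \<omega>}" for d
    have card: "card (T d) = card {k \<in> c ` I. reverses d k \<omega>}" for d
    proof -
      have "{k \<in> c ` I. reverses d k \<omega>} = c ` T d" unfolding T_def by auto
      moreover have "inj_on c (T d)" using inj by (rule inj_on_subset) (auto simp: T_def)
      ultimately show ?thesis by (simp add: card_image)
    qed
    show "emeasure ?P ?E \<le> ?\<kappa> + (indicator (F a) \<omega> + indicator (F b) \<omega>)"
    proof (cases "\<omega> \<in> F a \<or> \<omega> \<in> F b")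
      case True
      have "emeasure ?P ?E \<le> 1" by (rule measure_pmf.emeasure_le_1)
      also have "1 \<le> (indicator (F a) \<omega> + indicator (F b) \<omega> :: ennreal)"
        using True by (auto simp: indicator_def)
      also have "\<dots> \<le> ?\<kappa> + (indicator (F a) \<omega> + indicator (F b) \<omega>)" by simp
      finally show ?thesis .
    next
      case False
      then have m: "m \<le> card (T a)" "m \<le> card (T b)" using \<omega> by (auto simp: F_def card)
      have "?E = {u. \<bar>\<delta> * grid_sum L (2 * H) (mixed_windows \<xi> w u) (\<lambda>k. f k \<omega> $ a)\<bar> \<le> \<rho> \<and>
          \<bar>\<delta> * grid_sum L (2 * H) (mixed_windows \<xi> w u) (\<lambda>k. f k \<omega> $ b)\<bar> \<le> \<rho>}"
        using \<omega> by (simp add: grid_box_def)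
      also have "emeasure ?P \<dots> \<le> ?\<kappa>"
      proof (rule emeasure_grid_sums_small_le[OF pos])
        show "T a \<subseteq> {i. i < L \<and> \<xi> i}" "T b \<subseteq> {i. i < L \<and> \<xi> i}" by (auto simp: T_def I_def)
      qed (use ab m in \<open>auto simp: T_def reverses_def c_def axis_def\<close>)
      finally have "emeasure ?P ?E \<le> ?\<kappa>" .
      also have "\<dots> \<le> ?\<kappa> + (indicator (F a) \<omega> + indicator (F b) \<omega>)" by simp
      finally show ?thesis .
    qed
  qed
  also have "\<dots> = ?\<kappa> + (emeasure M (F a) + emeasure M (F b))"
    using F by (simp add: nn_integral_add emeasure_space_1)
  also have "\<dots> \<le> ?\<kappa> + (ennreal (2 ^ m * reversal_decay ^ card I) + ennreal (2 ^ m * reversal_decay ^ card I))"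
  proof -
    have "emeasure M (F d) \<le> ennreal (2 ^ m * reversal_decay ^ card I)" for d
      using emeasure_few_reversals_le[of "c ` I" d m] inj unfolding F_def by (simp add: card_image)
    then show ?thesis by (intro add_left_mono add_mono)
  qed
  also have "ennreal (2 ^ m * reversal_decay ^ card I) + ennreal (2 ^ m * reversal_decay ^ card I)
     = ennreal (2 * 2 ^ m) * ennreal (reversal_decay ^ card I)"
  proof -
    have nn: "0 \<le> 2 ^ m * reversal_decay ^ card I" using reversal_decay_bounds by simp
    have "ennreal (2 ^ m * reversal_decay ^ card I) + ennreal (2 ^ m * reversal_decay ^ card I)
       = ennreal (2 ^ m * reversal_decay ^ card I + 2 ^ m * reversal_decay ^ card I)"
      by (rule ennreal_plus[symmetric]) (use nn in auto)
    also have "2 ^ m * reversal_decay ^ card I + 2 ^ m * reversal_decay ^ card I = (2 * 2 ^ m) * reversal_decay ^ card I" by simp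
    also have "ennreal \<dots> = ennreal (2 * 2 ^ m) * ennreal (reversal_decay ^ card I)"
      by (rule ennreal_mult) (use reversal_decay_bounds in auto)
    finally show ?thesis .
  qed
  finally show ?thesis unfolding I_def .
qed

text \<open>
  The first summand is the concentration bound given at least \<open>m\<close> reversals on each axis, the
  second one bounds the probability that one of the axes sees fewer of them. The bound \<open>q0\<close>
  concerns the second half of the windows, since a window near time \<open>0\<close>, where the rate may be very
  large, is unlikely to contain exactly one point.
\<close>

lemma grid_box_prob_le:
  assumes ab: "a \<noteq> b" and pos: "0 < H" "0 < m" "0 < \<delta>" "0 \<le> \<rho>" "0 < K"
    and mass: "\<And>j. j < 2 * K * (2 * H) \<Longrightarrow> 0 < cell_mass \<delta> j"
    and q: "\<And>i. i < 2 * K \<Longrightarrow> 0 \<le> q i \<and> q i < 1" "\<And>i. K \<le> i \<Longrightarrow> i < 2 * K \<Longrightarrow> q0 \<le> q i"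
    and minor: "\<And>i u. i < 2 * K \<Longrightarrow> u < 2 * H \<Longrightarrow> q i \<le> real (2 * H)
      * pmf (Pi_pmf {..<2 * H} 0 (\<lambda>l. poisson_pmf (cell_mass \<delta> (i * (2 * H) + l)))) (single_point u)"
  defines "E \<equiv> {\<omega> \<in> space M. grid_box \<delta> (2 * K) (2 * H) \<rho> a b (window_counts \<delta> (2 * K) (2 * H) \<omega>) (\<lambda>k. f k \<omega>)}"
  shows "E \<in> events"
    and "prob E \<le> (\<rho> / \<delta> + 1)\<^sup>2 / (real H ^ 2 * real m) + 2 * 2 ^ m * (1 - q0 * (1 - reversal_decay)) ^ K"
proof -
  let ?L = "2 * K" and ?B = "2 * H" and ?y = reversal_decay
  let ?\<kappa> = "(\<rho> / \<delta> + 1)\<^sup>2 / (real H ^ 2 * real m)"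
  let ?R = "\<lambda>w. {\<omega> \<in> space M. grid_box \<delta> ?L ?B \<rho> a b w (\<lambda>k. f k \<omega>)}"
  have LB: "0 < ?L" "0 < ?B" using pos by auto
  note main = window_counts_directions_le[OF pos(3) LB mass grid_box_sets, of "\<lambda>_. \<delta>" "\<lambda>_. ?L" "\<lambda>_. ?B" "\<lambda>_. \<rho>" "\<lambda>_. a" "\<lambda>_. b" "\<lambda>w. w"]
  show "E \<in> events" unfolding E_def by (rule main(1))
  obtain rest where law: "window_counts_law \<delta> ?L ?B =
    Pi_pmf {..<?L} False (\<lambda>i. bernoulli_pmf (q i)) \<bind> (\<lambda>\<xi>.
    Pi_pmf {..<?L} (\<lambda>_. 0) rest \<bind> (\<lambda>w.
    Pi_pmf {..<?L} 0 (\<lambda>_. pmf_of_set {..<?B}) \<bind> (\<lambda>u.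
      return_pmf (\<lambda>i. if i < ?L then mixed_windows \<xi> w u i else (\<lambda>_. 0)))))"
    unfolding window_counts_law_def by (rule Pi_pmf_window_mixture[OF LB(2) q(1) minor])
  have "q0 \<le> q K" "q K < 1" using q(1)[of K] q(2)[of K] pos by auto
  then have "q0 * (1 - ?y) \<le> 1 * (1 - ?y)" using reversal_decay_bounds by (intro mult_right_mono) auto
  also have "1 * (1 - ?y) \<le> 1" using reversal_decay_bounds by simp
  finally have "q0 * (1 - ?y) \<le> 1" .
  then have nn: "0 \<le> (1 - q0 * (1 - ?y)) ^ K" by simp
  let ?mix = "\<lambda>\<xi> w u i. if i < ?L then mixed_windows \<xi> w u i else (\<lambda>_. 0)"
  have R: "?R (?mix \<xi> w u) = ?R (mixed_windows \<xi> w u)" for \<xi> w u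
    unfolding grid_box_def using grid_sum_cong[of ?L "?mix \<xi> w u" "mixed_windows \<xi> w u" ?B] by simp
  have "emeasure M E \<le> (\<integral>\<^sup>+x. emeasure M (?R x) \<partial>window_counts_law \<delta> ?L ?B)"
    unfolding E_def by (rule main(2))
  also have "\<dots> = (\<integral>\<^sup>+\<xi>. \<integral>\<^sup>+w. \<integral>\<^sup>+u. emeasure M (?R (mixed_windows \<xi> w u))
      \<partial>Pi_pmf {..<?L} 0 (\<lambda>_. pmf_of_set {..<?B}) \<partial>Pi_pmf {..<?L} (\<lambda>_. 0) rest \<partial>Pi_pmf {..<?L} False (\<lambda>i. bernoulli_pmf (q i)))"
    unfolding law nn_integral_bind_pmf by (subst nn_integral_return_pmf) (simp, simp only: R)
  also have "\<dots> \<le> (\<integral>\<^sup>+\<xi>. \<integral>\<^sup>+w. ennreal ?\<kappa> + ennreal (2 * 2 ^ m) * ennreal (?y ^ card {i. i < ?L \<and> \<xi> i})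
      \<partial>Pi_pmf {..<?L} (\<lambda>_. 0) rest \<partial>Pi_pmf {..<?L} False (\<lambda>i. bernoulli_pmf (q i)))"
    by (intro nn_integral_mono nn_integral_grid_box_uniform_le ab pos)
  also have "\<dots> = ennreal ?\<kappa> + ennreal (2 * 2 ^ m) * ennreal (\<Prod>i<?L. 1 - q i * (1 - ?y))"
    using q(1) reversal_decay_bounds
    by (simp add: nn_integral_add nn_integral_cmult less_imp_le nn_integral_power_card_bernoulli)
  also have "\<dots> \<le> ennreal ?\<kappa> + ennreal (2 * 2 ^ m) * ennreal ((1 - q0 * (1 - ?y)) ^ K)"
  proof (intro add_left_mono mult_left_mono ennreal_leI)
    have fac: "0 \<le> 1 - q i * (1 - ?y)" "1 - q i * (1 - ?y) \<le> 1" if "i < ?L" for i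
    proof -
      have "q i * (1 - ?y) \<le> 1 * 1" using q(1)[OF that] reversal_decay_bounds by (intro mult_mono) auto
      then show "0 \<le> 1 - q i * (1 - ?y)" by simp
      show "1 - q i * (1 - ?y) \<le> 1" using q(1)[OF that] reversal_decay_bounds by simp
    qed
    have halves: "{..<?L} = {..<K} \<union> {K..<?L}" by auto
    have "(\<Prod>i<?L. 1 - q i * (1 - ?y)) = (\<Prod>i<K. 1 - q i * (1 - ?y)) * (\<Prod>i\<in>{K..<?L}. 1 - q i * (1 - ?y))"
      by (subst halves, rule prod.union_disjoint) auto
    also have "\<dots> \<le> 1 * (\<Prod>i\<in>{K..<?L}. 1 - q0 * (1 - ?y))"
    proof (rule mult_mono)
      show "(\<Prod>i<K. 1 - q i * (1 - ?y)) \<le> 1" using fac by (intro prod_le_1) auto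
      show "(\<Prod>i\<in>{K..<?L}. 1 - q i * (1 - ?y)) \<le> (\<Prod>i\<in>{K..<?L}. 1 - q0 * (1 - ?y))"
        using fac q(2) reversal_decay_bounds by (intro prod_mono) (auto intro: mult_right_mono)
      show "0 \<le> (\<Prod>i\<in>{K..<?L}. 1 - q i * (1 - ?y))" using fac by (intro prod_nonneg) auto
    qed simp
    also have "\<dots> = (1 - q0 * (1 - ?y)) ^ K" by simp
    finally show "(\<Prod>i<?L. 1 - q i * (1 - ?y)) \<le> (1 - q0 * (1 - ?y)) ^ K" .
  qed simp
  also have "\<dots> = ennreal (?\<kappa> + 2 * 2 ^ m * (1 - q0 * (1 - ?y)) ^ K)"
  proof -
    have "0 \<le> ?\<kappa>" by simp
    then show ?thesis
      using nn ennreal_mult[of "2 * 2 ^ m" "(1 - q0 * (1 - ?y)) ^ K"]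
        ennreal_plus[of ?\<kappa> "2 * 2 ^ m * (1 - q0 * (1 - ?y)) ^ K"] by (metis mult_nonneg_nonneg zero_le_numeral zero_le_power)
  qed
  finally have le: "emeasure M E \<le> ennreal (?\<kappa> + 2 * 2 ^ m * (1 - q0 * (1 - ?y)) ^ K)" .
  have "0 \<le> ?\<kappa> + 2 * 2 ^ m * (1 - q0 * (1 - ?y)) ^ K" using nn by simp
  with le show "prob E \<le> ?\<kappa> + 2 * 2 ^ m * (1 - q0 * (1 - ?y)) ^ K"
    by (simp add: emeasure_eq_measure)
qed

end

section \<open>Approximating the walk by the grid\<close>

lemma pmf_poisson_single_point:
  assumes u: "u < B" and \<mu>: "\<And>l. l < B \<Longrightarrow> 0 < \<mu> l"
  shows "pmf (Pi_pmf {..<B} 0 (\<lambda>l. poisson_pmf (\<mu> l))) (single_point u) = exp (- (\<Sum>l<B. \<mu> l)) * \<mu> u"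
proof -
  have "pmf (Pi_pmf {..<B} 0 (\<lambda>l. poisson_pmf (\<mu> l))) (single_point u)
     = (\<Prod>l<B. pmf (poisson_pmf (\<mu> l)) (single_point u l))"
    using u by (intro pmf_Pi') (auto simp: single_point_def)
  also have "\<dots> = (\<Prod>l<B. exp (- \<mu> l) * (if l = u then \<mu> u else 1))"
    by (rule prod.cong[OF refl]) (auto simp: \<mu> single_point_def)
  also have "\<dots> = (\<Prod>l<B. exp (- \<mu> l)) * (\<Prod>l<B. if l = u then \<mu> u else 1)" by (rule prod.distrib)
  also have "(\<Prod>l<B. if l = u then \<mu> u else 1) = \<mu> u" using u by (simp add: prod.delta)
  also have "(\<Prod>l<B. exp (- \<mu> l)) = exp (- (\<Sum>l<B. \<mu> l))" by (simp add: exp_sum sum_negf[symmetric])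
  finally show ?thesis .
qed

lemma nn_integral_poisson_id:
  assumes "0 < \<mu>"
  shows "(\<integral>\<^sup>+k. ennreal (real k) \<partial>poisson_pmf \<mu>) = ennreal \<mu>"
proof -
  have sums: "(\<lambda>k. \<mu> ^ k / fact k * exp (- \<mu>) * real k) sums \<mu>"
  proof -
    have "(\<lambda>k. \<mu> ^ k / fact k) sums exp \<mu>" using exp_converges[of \<mu>] by (simp add: divide_inverse mult.commute)
    then have "(\<lambda>k. \<mu> * exp (- \<mu>) * (\<mu> ^ k / fact k)) sums (\<mu> * exp (- \<mu>) * exp \<mu>)" by (rule sums_mult)
    moreover have "\<mu> * exp (- \<mu>) * (\<mu> ^ k / fact k) = \<mu> ^ Suc k / fact (Suc k) * exp (- \<mu>) * real (Suc k)" for k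
    proof -
      have "real (Suc k) / fact (Suc k) = (1 / fact k :: real)" by (simp add: fact_Suc del: of_nat_Suc)
      then have "\<mu> ^ Suc k * exp (- \<mu>) * (real (Suc k) / fact (Suc k)) = \<mu> ^ Suc k * exp (- \<mu>) * (1 / fact k)"
        by (simp only:)
      then show ?thesis by (simp only: times_divide_eq_right times_divide_eq_left mult_1_right power_Suc mult_ac)
    qed
    ultimately have "(\<lambda>k. \<mu> ^ Suc k / fact (Suc k) * exp (- \<mu>) * real (Suc k)) sums (\<mu> * exp (- \<mu>) * exp \<mu>)"
      by (simp only:)
    moreover have "\<mu> * exp (- \<mu>) * exp \<mu> = \<mu>" by (simp add: exp_minus)
    ultimately have "(\<lambda>k. \<mu> ^ Suc k / fact (Suc k) * exp (- \<mu>) * real (Suc k)) sums \<mu>" by (simp only:)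
    then show ?thesis by (subst (asm) sums_Suc_iff) simp
  qed
  have "(\<integral>\<^sup>+k. ennreal (real k) \<partial>poisson_pmf \<mu>) = (\<Sum>k. ennreal (\<mu> ^ k / fact k * exp (- \<mu>) * real k))"
    unfolding nn_integral_measure_pmf nn_integral_count_space_nat
    using assms by (intro arg_cong[where f = suminf] ext) (simp add: ennreal_mult'[symmetric])
  also have "\<dots> = ennreal (\<Sum>k. \<mu> ^ k / fact k * exp (- \<mu>) * real k)"
    using assms sums by (intro suminf_ennreal2) (auto simp: sums_iff)
  finally show ?thesis using sums by (simp add: sums_iff)
qed

lemma sum_grid_counts:
  assumes w: "\<And>i l. i < L \<Longrightarrow> l < B \<Longrightarrow> w i l = c (i * B + l)"
  shows "grid_sum L B w g = (\<Sum>j<L * B. g (\<Sum>j'<Suc j. c j'))"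
proof -
  have "grid_sum L B w g = (\<Sum>i<L. \<Sum>l<B. g (\<Sum>j'<Suc (i * B + l). c j'))"
    unfolding grid_sum_def
  proof (intro sum.cong refl)
    fix i l assume il: "i \<in> {..<L}" "l \<in> {..<B}"
    have "points_before_window B w i = (\<Sum>i'<i. \<Sum>j\<in>{i' * B..<i' * B + B}. c j)"
      unfolding points_before_window_def
    proof (rule sum.cong[OF refl])
      fix i' assume "i' \<in> {..<i}"
      then have "(\<Sum>l<B. w i' l) = (\<Sum>l<B. c (i' * B + l))" using w il by (intro sum.cong) auto
      also have "\<dots> = (\<Sum>j\<in>{i' * B..<i' * B + B}. c j)"
        by (rule sum.reindex_bij_witness[of _ "\<lambda>j. j - i' * B" "\<lambda>l. i' * B + l"]) auto
      finally show "(\<Sum>l<B. w i' l) = (\<Sum>j\<in>{i' * B..<i' * B + B}. c j)" .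
    qed
    also have "\<dots> = (\<Sum>j<i * B. c j)" by (rule sum.nat_group)
    finally have before: "points_before_window B w i = (\<Sum>j<i * B. c j)" .
    have "(\<Sum>l'<Suc l. w i l') = (\<Sum>l'<Suc l. c (i * B + l'))" using w il by (intro sum.cong) auto
    also have "\<dots> = (\<Sum>j\<in>{i * B..<Suc (i * B + l)}. c j)"
      by (rule sum.reindex_bij_witness[of _ "\<lambda>j. j - i * B" "\<lambda>l. i * B + l"]) auto
    finally have "points_before_window B w i + (\<Sum>l'<Suc l. w i l')
       = (\<Sum>j<i * B. c j) + (\<Sum>j\<in>{i * B..<Suc (i * B + l)}. c j)" using before by simp
    also have "\<dots> = (\<Sum>j'<Suc (i * B + l). c j')"
      unfolding lessThan_atLeast0 by (rule sum.atLeastLessThan_concat) auto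
    finally show "g (points_before_window B w i + (\<Sum>l'<Suc l. w i l')) = g (\<Sum>j'<Suc (i * B + l). c j')" by simp
  qed
  also have "\<dots> = (\<Sum>i<L. \<Sum>j\<in>{i * B..<i * B + B}. g (\<Sum>j'<Suc j. c j'))"
  proof (rule sum.cong[OF refl])
    fix i
    show "(\<Sum>l<B. g (\<Sum>j'<Suc (i * B + l). c j')) = (\<Sum>j\<in>{i * B..<i * B + B}. g (\<Sum>j'<Suc j. c j'))"
      by (rule sum.reindex_bij_witness[of _ "\<lambda>j. j - i * B" "\<lambda>l. i * B + l"]) auto
  qed
  also have "\<dots> = (\<Sum>j<L * B. g (\<Sum>j'<Suc j. c j'))" by (rule sum.nat_group)
  finally show ?thesis .
qed

context orthogonal_walk
begin

lemma point_count_measurable: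
  assumes "A \<in> sets borel"
  shows "point_count \<tau> A \<in> measurable M (count_space UNIV)"
  unfolding point_count_def[abs_def] using assms by measurable

text \<open>
  Markov's inequality.
\<close>

lemma prob_point_count_gt_le:
  assumes A: "A \<in> sets borel" "bounded A" "A \<subseteq> {0..}" and N: "0 < N" and pos: "0 < (LINT t:A|lborel. r t)"
  shows "prob {\<omega> \<in> space M. N < point_count \<tau> A \<omega>} \<le> (LINT t:A|lborel. r t) / real N"
proof -
  define \<mu> where "\<mu> = (LINT t:A|lborel. r t)"
  let ?X = "point_count \<tau> A"
  have \<mu>: "0 < \<mu>" using pos by (simp add: \<mu>_def)
  have X [measurable]: "?X \<in> measurable M (count_space UNIV)" by (rule point_count_measurable[OF A(1)])
  have law: "distr M (count_space UNIV) ?X = measure_pmf (poisson_pmf \<mu>)"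
  proof (rule measure_eqI_countable[where A = UNIV])
    fix k :: nat
    have "emeasure (distr M (count_space UNIV) ?X) {k} = emeasure M {\<omega> \<in> space M. ?X \<omega> = k}"
      by (subst emeasure_distr) (auto intro!: arg_cong[where f = "emeasure M"])
    also have "\<dots> = ennreal (pmf (poisson_pmf \<mu>) k)"
      using \<mu> counts_poisson[OF A] by (simp add: emeasure_eq_measure \<mu>_def)
    finally show "emeasure (distr M (count_space UNIV) ?X) {k} = emeasure (measure_pmf (poisson_pmf \<mu>)) {k}"
      by (simp only: emeasure_pmf_single)
  qed auto
  have "ennreal (real N) * emeasure M {\<omega> \<in> space M. N < ?X \<omega>}
     = (\<integral>\<^sup>+\<omega>. ennreal (real N) * indicator {\<omega> \<in> space M. N < ?X \<omega>} \<omega> \<partial>M)"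
    by (subst nn_integral_cmult) auto
  also have "\<dots> \<le> (\<integral>\<^sup>+\<omega>. ennreal (real (?X \<omega>)) \<partial>M)"
    by (intro nn_integral_mono) (auto simp: indicator_def intro: ennreal_leI)
  also have "\<dots> = (\<integral>\<^sup>+k. ennreal (real k) \<partial>distr M (count_space UNIV) ?X)"
    by (subst nn_integral_distr) auto
  also have "\<dots> = ennreal \<mu>" unfolding law by (rule nn_integral_poisson_id[OF \<mu>])
  finally have "real N * prob {\<omega> \<in> space M. N < ?X \<omega>} \<le> \<mu>"
    using \<mu> by (simp add: emeasure_eq_measure flip: ennreal_mult)
  then show ?thesis using N by (simp add: \<mu>_def field_simps)
qed

lemma AE_jump_times: "AE \<omega> in M. jump_times (\<lambda>k. \<tau> k \<omega>)"
  using points_ordered points_locally_finite AE_space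
proof eventually_elim
  case (elim \<omega>)
  show ?case
  proof
    show z: "\<tau> 0 \<omega> = 0" by (rule start_time) (use elim in auto)
    have step: "\<tau> k \<omega> \<le> \<tau> (Suc k) \<omega>" for k
    proof (cases k)
      case 0
      then show ?thesis using elim z by simp
    next
      case (Suc j)
      then have "k \<in> {1..}" "Suc k \<in> {1..}" by auto
      then show ?thesis using elim strict_mono_onD[of "{1..}" "\<lambda>k. \<tau> k \<omega>" k "Suc k"] by simp
    qed
    then show "mono (\<lambda>k. \<tau> k \<omega>)" by (simp add: mono_iff_le_Suc)
    fix T
    have "{k. \<tau> k \<omega> \<le> T} \<subseteq> insert 0 {k. 1 \<le> k \<and> \<tau> k \<omega> \<le> T}" by auto
    then show "finite {k. \<tau> k \<omega> \<le> T}" by (rule finite_subset) (use elim in auto)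
  qed
qed

lemma walk_grid_sum_approx:
  assumes jt: "jump_times (\<lambda>k. \<tau> k \<omega>)" and le1: "\<And>k a. \<bar>f k \<omega> $ a\<bar> \<le> 1" and \<delta>: "0 < \<delta>"
  shows "\<bar>walk (\<lambda>k. \<tau> k \<omega>) (\<lambda>k. f k \<omega>) (real (L * B) * \<delta>) $ a
      - \<delta> * grid_sum L B (window_counts \<delta> L B \<omega>) (\<lambda>k. f k \<omega> $ a)\<bar>
    \<le> 2 * \<delta> * real (point_count \<tau> {0..<real (L * B) * \<delta>} \<omega>)"
proof -
  interpret jump_times "\<lambda>k. \<tau> k \<omega>" by (rule jt)
  let ?c = "\<lambda>j. point_count \<tau> (time_cell \<delta> j) \<omega>"
  have c: "card {k. 1 \<le> k \<and> \<tau> k \<omega> < real m * \<delta>} = (\<Sum>j<m. ?c j)" for m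
    unfolding point_count_def time_cell_def using \<delta> by (intro card_points_before_grid) simp
  have total: "card {k. 1 \<le> k \<and> \<tau> k \<omega> < t} = point_count \<tau> {0..<t} \<omega>" for t
    unfolding point_count_def by (rule arg_cong[where f = card]) (use s_nonneg in auto)
  have "grid_sum L B (window_counts \<delta> L B \<omega>) (\<lambda>k. f k \<omega> $ a) = (\<Sum>j<L * B. f (\<Sum>j'<Suc j. ?c j') \<omega> $ a)"
    by (rule sum_grid_counts) (simp add: window_counts_def)
  also have "\<dots> = (\<Sum>j<L * B. f (card {k. 1 \<le> k \<and> \<tau> k \<omega> < real (Suc j) * \<delta>}) \<omega> $ a)"
    by (simp only: c)
  finally show ?thesis
    using walk_riemann_sum[of \<delta> "\<lambda>k. f k \<omega>" a "L * B"] le1 \<delta> by (simp only: total less_imp_le)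
qed

end

section \<open>Rates that decay like a power of time\<close>

lemma powr_div_square:
  assumes "0 < n"
  shows "real n powr (1 - \<alpha>) / real n ^ 2 = real n powr (- 1 - \<alpha>)"
proof -
  have "real n powr (- 1 - \<alpha>) = real n powr ((1 - \<alpha>) - 2)" by (rule arg_cong[where f = "(powr) (real n)"]) simp
  also have "\<dots> = real n powr (1 - \<alpha>) / real n powr 2" by (rule powr_diff)
  also have "real n powr 2 = real n ^ 2" using assms by (simp add: powr_numeral)
  finally show ?thesis by simp
qed

locale power_rate_walk = orthogonal_walk M "\<lambda>t. t powr - \<alpha>" \<tau> f
  for M :: "'a measure" and \<alpha> :: real and \<tau> :: "nat \<Rightarrow> 'a \<Rightarrow> real" and f :: "nat \<Rightarrow> 'a \<Rightarrow> real ^ 'd" +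
  assumes alpha: "0 < \<alpha>" "\<alpha> < 1"
begin

lemma rate_integrable_cell:
  assumes "0 < \<delta>"
  shows "set_integrable lborel (time_cell \<delta> j) (\<lambda>t. t powr - \<alpha>)"
proof (rule set_integrable_subset)
  show "set_integrable lborel {0..real (Suc j) * \<delta>} (\<lambda>t. t powr - \<alpha>)"
    using assms by (intro set_integral_powr_minus alpha) simp
  have "0 \<le> real j * \<delta>" using assms by simp
  then show "time_cell \<delta> j \<subseteq> {0..real (Suc j) * \<delta>}" unfolding time_cell_def by auto
qed (simp add: time_cell_def)

lemma integral_const_cell:
  assumes "0 < \<delta>"
  shows "set_integrable lborel (time_cell \<delta> j) (\<lambda>_. c :: real)" "(LINT t:time_cell \<delta> j|lborel. c) = \<delta> * c"
proof -
  have le: "real j * \<delta> \<le> real (Suc j) * \<delta>" using assms by (simp add: algebra_simps)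
  have len: "real (Suc j) * \<delta> - real j * \<delta> = \<delta>" by (simp add: algebra_simps)
  show "set_integrable lborel (time_cell \<delta> j) (\<lambda>_. c)"
    using le by (simp add: time_cell_def set_integrable_def)
  show "(LINT t:time_cell \<delta> j|lborel. c) = \<delta> * c"
    unfolding time_cell_def using le len by (simp add: set_lebesgue_integral_def)
qed

lemma cell_mass_lower:
  assumes \<delta>: "0 < \<delta>" and N: "real (Suc j) * \<delta> \<le> N"
  shows "\<delta> * N powr - \<alpha> \<le> cell_mass \<delta> j"
proof -
  have "(LINT t:time_cell \<delta> j|lborel. N powr - \<alpha>) \<le> (LINT t:time_cell \<delta> j|lborel. t powr - \<alpha>)"
  proof (rule set_integral_mono_AE[OF integral_const_cell(1)[OF \<delta>] rate_integrable_cell[OF \<delta>]])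
    show "AE t\<in>time_cell \<delta> j in lborel. N powr - \<alpha> \<le> t powr - \<alpha>"
      \<comment> \<open>At \<open>t = 0\<close> the inequality fails, because \<open>0 powr - \<alpha> = 0\<close>.\<close>
      using AE_lborel_singleton[of "0::real"]
    proof eventually_elim
      case (elim t)
      show ?case
      proof
        assume "t \<in> time_cell \<delta> j"
        then have "0 \<le> t" "t \<le> N" using \<delta> N by (auto simp: time_cell_def intro: order_trans[rotated])
        then show "N powr - \<alpha> \<le> t powr - \<alpha>" using elim alpha by (intro powr_mono2') auto
      qed
    qed
  qed
  then show ?thesis unfolding cell_mass_def by (simp only: integral_const_cell(2)[OF \<delta>])
qed

lemma cell_mass_upper:
  assumes \<delta>: "0 < \<delta>" and N: "0 < N" "N / 2 \<le> real j * \<delta>"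
  shows "cell_mass \<delta> j \<le> \<delta> * (2 * N powr - \<alpha>)"
proof -
  have "(LINT t:time_cell \<delta> j|lborel. t powr - \<alpha>) \<le> (LINT t:time_cell \<delta> j|lborel. 2 * N powr - \<alpha>)"
  proof (rule set_integral_mono[OF rate_integrable_cell[OF \<delta>] integral_const_cell(1)[OF \<delta>]])
    fix t assume "t \<in> time_cell \<delta> j"
    then have "N / 2 \<le> t" using N by (auto simp: time_cell_def)
    then have "t powr - \<alpha> \<le> (N / 2) powr - \<alpha>" using alpha N by (intro powr_mono2') auto
    also have "\<dots> = 2 powr \<alpha> * N powr - \<alpha>" using N by (simp add: powr_divide powr_minus field_simps)
    also have "\<dots> \<le> 2 powr 1 * N powr - \<alpha>" using alpha by (intro mult_right_mono powr_mono) auto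
    finally show "t powr - \<alpha> \<le> 2 * N powr - \<alpha>" by simp
  qed
  then show ?thesis unfolding cell_mass_def by (simp only: integral_const_cell(2)[OF \<delta>])
qed

lemma prob_many_points_le:
  assumes n: "0 < n"
  shows "prob {\<omega> \<in> space M. n ^ 2 < point_count \<tau> {0..<real n} \<omega>} \<le> real n powr (- 1 - \<alpha>) / (1 - \<alpha>)"
proof -
  have cell: "{0..<real n} = time_cell (real n) 0" by (simp add: time_cell_def)
  let ?I = "LINT t:{0..<real n}|lborel. t powr - \<alpha>"
  have "0 < real n * real n powr - \<alpha>" using n by simp
  also have "\<dots> \<le> ?I"
    using cell_mass_lower[of "real n" 0 "real n"] n unfolding cell_mass_def cell by simp
  finally have pos: "0 < ?I" .
  have "?I \<le> (LINT t:{0..real n}|lborel. t powr - \<alpha>)"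
    unfolding set_lebesgue_integral_def
  proof (rule integral_mono)
    show "integrable lborel (\<lambda>t. indicat_real {0..<real n} t *\<^sub>R t powr - \<alpha>)"
      using rate_integrable_cell[of "real n" 0] n unfolding set_integrable_def cell by simp
    show "integrable lborel (\<lambda>t. indicat_real {0..real n} t *\<^sub>R t powr - \<alpha>)"
      using set_integral_powr_minus(1)[OF alpha, of "real n"] unfolding set_integrable_def by simp
  qed (auto simp: indicator_def)
  also have "\<dots> = real n powr (1 - \<alpha>) / (1 - \<alpha>)"
    using set_integral_powr_minus(2)[OF alpha, of "real n"] unfolding cumulative_rate_def by simp
  finally have I: "?I \<le> real n powr (1 - \<alpha>) / (1 - \<alpha>)" .
  have "prob {\<omega> \<in> space M. n ^ 2 < point_count \<tau> {0..<real n} \<omega>} \<le> ?I / real (n ^ 2)"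
    using n pos bounded_subset[OF bounded_closed_interval, of "{0..<real n}" 0 "real n"]
    by (intro prob_point_count_gt_le) auto
  also have "\<dots> \<le> real n powr (1 - \<alpha>) / (1 - \<alpha>) / real n ^ 2"
    unfolding of_nat_power by (intro divide_right_mono I) simp
  also have "\<dots> = real n powr (1 - \<alpha>) / real n ^ 2 / (1 - \<alpha>)" by simp
  also have "\<dots> = real n powr (- 1 - \<alpha>) / (1 - \<alpha>)" using n by (simp only: powr_div_square)
  finally show ?thesis .
qed

definition half_windows :: "nat \<Rightarrow> nat" where
  "half_windows n = nat \<lfloor>real n powr (1 - \<alpha>) / 2\<rfloor>"

text \<open>
  The length of a cell: \<open>[0, n)\<close> is cut into \<open>2 * half_windows n\<close> windows of \<open>2 * n ^ 3\<close> cells. The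
  third power makes the discretisation error negligible even with \<open>n\<^sup>2\<close> points before time \<open>n\<close>.
\<close>

definition mesh :: "nat \<Rightarrow> real" where
  "mesh n = real n / real (2 * half_windows n * (2 * n ^ 3))"

definition near_origin :: "'d \<Rightarrow> 'd \<Rightarrow> real \<Rightarrow> nat \<Rightarrow> 'a set" where
  "near_origin a b \<rho> n = {\<omega> \<in> space M. grid_box (mesh n) (2 * half_windows n) (2 * n ^ 3) \<rho> a b
     (window_counts (mesh n) (2 * half_windows n) (2 * n ^ 3) \<omega>) (\<lambda>k. f k \<omega>)}"

lemma half_windows_bounds:
  "real (half_windows n) \<le> real n powr (1 - \<alpha>) / 2" "real n powr (1 - \<alpha>) / 2 < real (half_windows n) + 1"
proof -
  have "0 \<le> real n powr (1 - \<alpha>) / 2" by simp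
  then show "real (half_windows n) \<le> real n powr (1 - \<alpha>) / 2" "real n powr (1 - \<alpha>) / 2 < real (half_windows n) + 1"
    unfolding half_windows_def by linarith+
qed

text \<open>
  Each window has length \<open>n / (2 * K)\<close>, which is between \<open>1\<close> and \<open>2\<close> times \<open>n powr \<alpha>\<close>. The rate is
  at least \<open>n powr (- \<alpha>)\<close> on \<open>(0, n)\<close> and at most twice that on the second half, so the
  windows there have mass at most \<open>4\<close>; this is where \<open>exp (- 4)\<close> comes from.
\<close>

lemma near_origin_prob_le_explicit:
  assumes ab: "a \<noteq> b" and \<rho>: "0 \<le> \<rho>" and n: "0 < n" "0 < half_windows n" and m: "0 < m"
  shows "near_origin a b \<rho> n \<in> events"
    and "prob (near_origin a b \<rho> n) \<le> (\<rho> / mesh n + 1)\<^sup>2 / (real (n ^ 3) ^ 2 * real m)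
      + 2 * 2 ^ m * (1 - exp (- 4) * (1 - reversal_decay)) ^ half_windows n"
proof -
  define K H \<delta> where "K = half_windows n" and "H = n ^ 3" and "\<delta> = mesh n"
  have pos: "0 < K" "0 < H" "0 < real n" using n by (auto simp: K_def H_def)
  have \<delta>: "\<delta> = real n / real (2 * K * (2 * H))" by (simp add: \<delta>_def mesh_def K_def H_def)
  have \<delta>_pos: "0 < \<delta>" unfolding \<delta> using pos by simp
  have total: "real (2 * K * (2 * H)) * \<delta> = real n" unfolding \<delta> using pos by simp
  have half: "real (K * (2 * H)) * \<delta> = real n / 2" using total by simp
  let ?\<mu> = "\<lambda>i l. cell_mass \<delta> (i * (2 * H) + l)"
  \<comment> \<open>The mass that a window would have if the rate were \<open>n powr - \<alpha>\<close> throughout.\<close>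
  define x where "x = real (2 * H) * (\<delta> * real n powr - \<alpha>)"
  define q where "q i = x * exp (- (\<Sum>l<2 * H. ?\<mu> i l))" for i
  have idx: "i * (2 * H) + l < 2 * K * (2 * H)" if "i < 2 * K" "l < 2 * H" for i l
  proof -
    have "i * (2 * H) + l < Suc i * (2 * H)" using that by simp
    also have "\<dots> \<le> 2 * K * (2 * H)" using that by (intro mult_le_mono1) simp
    finally show ?thesis .
  qed
  have lower: "\<delta> * real n powr - \<alpha> \<le> cell_mass \<delta> j" if "j < 2 * K * (2 * H)" for j
  proof (rule cell_mass_lower[OF \<delta>_pos])
    have "Suc j \<le> 2 * K * (2 * H)" using that by simp
    then have "real (Suc j) * \<delta> \<le> real (2 * K * (2 * H)) * \<delta>"
      using \<delta>_pos by (intro mult_right_mono of_nat_mono) auto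
    then show "real (Suc j) * \<delta> \<le> real n" using total by simp
  qed
  have mass_pos: "0 < cell_mass \<delta> j" if "j < 2 * K * (2 * H)" for j
    using lower[OF that] \<delta>_pos pos by (intro less_le_trans[OF _ lower[OF that]]) simp
  have x_eq: "x = real n powr (1 - \<alpha>) / (2 * real K)"
  proof -
    have "x = real n * real n powr - \<alpha> / (2 * real K)" unfolding x_def \<delta> using pos by simp
    also have "real n * real n powr - \<alpha> = real n powr (1 - \<alpha>)" using pos by (simp add: powr_diff powr_minus_divide)
    finally show ?thesis .
  qed
  have x1: "1 \<le> x" using half_windows_bounds(1)[of n] pos unfolding x_eq K_def[symmetric] by simp
  have x2: "x \<le> 2"
  proof -
    have "1 \<le> real K" using pos by simp
    then have "real n powr (1 - \<alpha>) \<le> 2 * (2 * real K)" using half_windows_bounds(2)[of n] unfolding K_def[symmetric] by linarith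
    then show ?thesis unfolding x_eq using pos by (simp add: pos_divide_le_eq)
  qed
  have q_range: "0 \<le> q i \<and> q i < 1" if i: "i < 2 * K" for i
  proof
    have "x = (\<Sum>l<2 * H. \<delta> * real n powr - \<alpha>)" by (simp add: x_def)
    also have "\<dots> \<le> (\<Sum>l<2 * H. ?\<mu> i l)" using idx[OF i] by (intro sum_mono lower) simp
    finally have "q i \<le> x * exp (- x)" unfolding q_def using x1 by (intro mult_left_mono) auto
    also have "\<dots> < 1"
    proof -
      have "x < exp x" using exp_ge_add_one_self[of x] by linarith
      then show ?thesis by (simp add: exp_minus field_simps)
    qed
    finally show "q i < 1" .
    show "0 \<le> q i" unfolding q_def using x1 by simp
  qed
  have minor: "q i \<le> real (2 * H) * pmf (Pi_pmf {..<2 * H} 0 (\<lambda>l. poisson_pmf (?\<mu> i l))) (single_point u)"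
    if i: "i < 2 * K" and u: "u < 2 * H" for i u
  proof -
    have "pmf (Pi_pmf {..<2 * H} 0 (\<lambda>l. poisson_pmf (?\<mu> i l))) (single_point u)
       = exp (- (\<Sum>l<2 * H. ?\<mu> i l)) * ?\<mu> i u"
      by (rule pmf_poisson_single_point[OF u]) (use idx[OF i] mass_pos in auto)
    moreover have "\<delta> * real n powr - \<alpha> \<le> ?\<mu> i u" by (rule lower[OF idx[OF i u]])
    then have "real (2 * H) * exp (- (\<Sum>l<2 * H. ?\<mu> i l)) * (\<delta> * real n powr - \<alpha>)
       \<le> real (2 * H) * exp (- (\<Sum>l<2 * H. ?\<mu> i l)) * ?\<mu> i u" by (intro mult_left_mono) auto
    ultimately show ?thesis unfolding q_def x_def by (simp only: mult_ac)
  qed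
  have q_lower: "exp (- 4) \<le> q i" if Ki: "K \<le> i" "i < 2 * K" for i
  proof -
    have "(\<Sum>l<2 * H. ?\<mu> i l) \<le> (\<Sum>l<2 * H. \<delta> * (2 * real n powr - \<alpha>))"
    proof (rule sum_mono)
      fix l
      have "K * (2 * H) \<le> i * (2 * H) + l" using Ki(1) by (intro trans_le_add1 mult_le_mono1)
      then have "real (K * (2 * H)) * \<delta> \<le> real (i * (2 * H) + l) * \<delta>"
        using \<delta>_pos by (intro mult_right_mono of_nat_mono) auto
      then show "?\<mu> i l \<le> \<delta> * (2 * real n powr - \<alpha>)"
        using half pos by (intro cell_mass_upper[OF \<delta>_pos]) auto
    qed
    also have "\<dots> = 2 * x" by (simp add: x_def)
    also have "\<dots> \<le> 4" using x2 by simp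
    finally have "exp (- 4) \<le> exp (- (\<Sum>l<2 * H. ?\<mu> i l))" by simp
    also have "\<dots> \<le> q i" unfolding q_def using x1 by simp
    finally show ?thesis .
  qed
  note box = grid_box_prob_le[OF ab pos(2) m \<delta>_pos \<rho> pos(1) mass_pos q_range q_lower minor]
  show "near_origin a b \<rho> n \<in> events"
    unfolding near_origin_def \<delta>_def[symmetric] K_def[symmetric] H_def[symmetric] by (rule box(1))
  show "prob (near_origin a b \<rho> n) \<le> (\<rho> / mesh n + 1)\<^sup>2 / (real (n ^ 3) ^ 2 * real m)
      + 2 * 2 ^ m * (1 - exp (- 4) * (1 - reversal_decay)) ^ half_windows n"
    unfolding near_origin_def \<delta>_def[symmetric] K_def[symmetric] H_def[symmetric] by (rule box(2))
qed

text \<open>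
  The required number \<open>m\<close> of reversals is about \<open>c * K\<close> for \<open>K\<close> windows in the second half, where
  \<open>c\<close> is chosen such that \<open>2 powr (c * K)\<close> consumes only half of the exponential decay \<open>z ^ K\<close>.
\<close>

lemma near_origin_prob_le:
  assumes ab: "a \<noteq> b" and \<rho>: "0 \<le> \<rho>"
  obtains C D \<beta> where "0 < \<beta>" and "\<And>n. 0 < n \<Longrightarrow> 0 < half_windows n \<Longrightarrow>
    prob (near_origin a b \<rho> n) \<le> C * real n powr (- 1 - \<alpha>) + D * exp (- (\<beta> * real n powr (1 - \<alpha>)))"
proof -
  define z where "z = 1 - exp (- 4) * (1 - reversal_decay)"
  define w where "w = sqrt z"
  \<comment> \<open>With this choice \<open>2 powr c * z = w\<close>, so half of the decay rate survives.\<close>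
  define c where "c = log 2 (1 / w)"
  have z: "0 < z" "z < 1"
  proof -
    have "exp (- 4) * (1 - reversal_decay) < 1 * 1"
      using reversal_decay_bounds by (intro mult_strict_mono) auto
    moreover have "0 < exp (- 4 :: real) * (1 - reversal_decay)" using reversal_decay_bounds by simp
    ultimately show "0 < z" "z < 1" unfolding z_def by auto
  qed
  then have w: "0 < w" "w < 1" "w * w = z" unfolding w_def by (auto simp: real_sqrt_lt_1_iff)
  have c: "0 < c" "2 powr c = 1 / w" unfolding c_def using w by (auto simp: zero_less_log_cancel_iff)
  show ?thesis
  proof (rule that[of "- ln w / 2" "(4 * \<rho> + 1)\<^sup>2 / (2 * c)" "4 / w"])
    show "0 < - ln w / 2" using w by simp
    fix n assume n: "0 < n" "0 < half_windows n"
    define K where "K = half_windows n"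
    define m where "m = nat \<lfloor>c * real K\<rfloor> + 1"
    have K: "1 \<le> real K" "real K \<le> real n powr (1 - \<alpha>) / 2" "real n powr (1 - \<alpha>) / 2 < real K + 1"
      using n half_windows_bounds[of n] by (auto simp: K_def)
    have cK: "0 < c * real K" using c K by simp
    have m: "c * real K \<le> real m" "real m \<le> c * real K + 1" unfolding m_def using cK by linarith+
    have aux: "prob (near_origin a b \<rho> n) \<le> (\<rho> / mesh n + 1)\<^sup>2 / (real (n ^ 3) ^ 2 * real m) + 2 * 2 ^ m * z ^ K"
      using near_origin_prob_le_explicit(2)[OF ab \<rho> n, of m] unfolding z_def K_def by (simp add: m_def)
    have "(\<rho> / mesh n + 1)\<^sup>2 / (real (n ^ 3) ^ 2 * real m) \<le> (4 * \<rho> + 1)\<^sup>2 / (2 * c) * real n powr (- 1 - \<alpha>)"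
    proof -
      have "(\<rho> / mesh n + 1) / real (n ^ 3) = \<rho> * 4 * real K / real n + 1 / real (n ^ 3)"
        unfolding mesh_def K_def[symmetric] using n by (simp add: field_simps)
      also have "1 / real (n ^ 3) \<le> real K / real n"
      proof -
        have "1 / real (n ^ 3) \<le> 1 / real n"
          using n by (intro divide_left_mono) (auto simp: self_le_power)
        also have "\<dots> \<le> real K / real n" using K by (intro divide_right_mono) auto
        finally show ?thesis .
      qed
      also have "\<rho> * 4 * real K / real n + real K / real n = (4 * \<rho> + 1) * real K / real n"
        by (simp add: algebra_simps flip: add_divide_distrib)
      finally have "(\<rho> / mesh n + 1) / real (n ^ 3) \<le> (4 * \<rho> + 1) * real K / real n" by simp
      moreover have "0 \<le> (\<rho> / mesh n + 1) / real (n ^ 3)" using \<rho> by (simp add: mesh_def)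
      ultimately have "((\<rho> / mesh n + 1) / real (n ^ 3))\<^sup>2 \<le> ((4 * \<rho> + 1) * real K / real n)\<^sup>2"
        by (intro power_mono)
      then have "((\<rho> / mesh n + 1) / real (n ^ 3))\<^sup>2 / real m \<le> ((4 * \<rho> + 1) * real K / real n)\<^sup>2 / (c * real K)"
        using m cK by (intro frac_le) auto
      also have "\<dots> = (4 * \<rho> + 1)\<^sup>2 / c * (real K / real n ^ 2)"
        using K n c by (simp add: power2_eq_square field_simps)
      also have "\<dots> \<le> (4 * \<rho> + 1)\<^sup>2 / c * ((real n powr (1 - \<alpha>) / 2) / real n ^ 2)"
        using K c by (intro mult_left_mono divide_right_mono) auto
      also have "\<dots> = (4 * \<rho> + 1)\<^sup>2 / (2 * c) * (real n powr (1 - \<alpha>) / real n ^ 2)" by simp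
      also have "real n powr (1 - \<alpha>) / real n ^ 2 = real n powr (- 1 - \<alpha>)" by (rule powr_div_square[OF n(1)])
      finally show ?thesis by (simp add: power_divide)
    qed
    moreover have "2 * 2 ^ m * z ^ K \<le> 4 / w * exp (- (- ln w / 2 * real n powr (1 - \<alpha>)))"
    proof -
      have "(2::real) ^ m = 2 powr real m" by (simp add: powr_realpow)
      also have "\<dots> \<le> 2 powr (c * real K + 1)" using m by (intro powr_mono) auto
      also have "\<dots> = 2 * (1 / w) powr real K" using c by (simp add: powr_add flip: powr_powr)
      also have "\<dots> = 2 * (1 / w) ^ K" using w by (simp add: powr_realpow)
      finally have "2 * 2 ^ m * z ^ K \<le> 2 * (2 * (1 / w) ^ K) * z ^ K"
        using z by (intro mult_right_mono mult_left_mono) auto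
      also have "\<dots> = 4 * (1 / w * z) ^ K" by (simp only: power_mult_distrib)
      also have "1 / w * z = w" using w by (simp add: field_simps)
      also have "w ^ K = exp (real K * ln w)" using w by (simp add: exp_of_nat_mult)
      also have "4 * exp (real K * ln w) \<le> 4 * exp ((real n powr (1 - \<alpha>) / 2 - 1) * ln w)"
      proof -
        have "real K * ln w \<le> (real n powr (1 - \<alpha>) / 2 - 1) * ln w"
          using K w by (intro mult_right_mono_neg) auto
        then show ?thesis by simp
      qed
      also have "\<dots> = 4 / w * exp (- (- ln w / 2 * real n powr (1 - \<alpha>)))"
      proof -
        have "(real n powr (1 - \<alpha>) / 2 - 1) * ln w = - (- ln w / 2 * real n powr (1 - \<alpha>)) - ln w"
          by (simp add: algebra_simps)
        then show ?thesis using w by (simp add: exp_diff)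
      qed
      finally show ?thesis .
    qed
    ultimately show "prob (near_origin a b \<rho> n)
      \<le> (4 * \<rho> + 1)\<^sup>2 / (2 * c) * real n powr (- 1 - \<alpha>) + 4 / w * exp (- (- ln w / 2 * real n powr (1 - \<alpha>)))"
      using aux by linarith
  qed
qed

lemma eventually_half_windows_pos: "eventually (\<lambda>n. 0 < half_windows n) sequentially"
proof -
  have "eventually (\<lambda>n::nat. 1 \<le> real n powr (1 - \<alpha>) / 2) sequentially" using alpha by real_asymp
  then show ?thesis by eventually_elim (simp add: half_windows_def)
qed

text \<open>
  Borel--Cantelli. The grid approximates the walk up to \<open>1\<close> unless there are more than \<open>n\<^sup>2\<close> points
  before time \<open>n\<close>, which has summable probability as well.
\<close>

lemma AE_eventually_walk_outside:
  assumes ab: "a \<noteq> b" and \<rho>: "0 \<le> \<rho>"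
  shows "AE \<omega> in M. eventually (\<lambda>n. 
    \<rho> < \<bar>walk (\<lambda>k. \<tau> k \<omega>) (\<lambda>k. f k \<omega>) (real n) $ a\<bar> \<or> \<rho> < \<bar>walk (\<lambda>k. \<tau> k \<omega>) (\<lambda>k. f k \<omega>) (real n) $ b\<bar>) sequentially"
proof -
  obtain C D \<beta> where \<beta>: "0 < \<beta>" and bound: "\<And>n. 0 < n \<Longrightarrow> 0 < half_windows n \<Longrightarrow>
    prob (near_origin a b (\<rho> + 1) n) \<le> C * real n powr (- 1 - \<alpha>) + D * exp (- (\<beta> * real n powr (1 - \<alpha>)))"
  proof -
    have "0 \<le> \<rho> + 1" using \<rho> by simp
    then show thesis by (rule near_origin_prob_le[OF ab]) (rule that)
  qed
  let ?many = "\<lambda>n. {\<omega> \<in> space M. n ^ 2 < point_count \<tau> {0..<real n} \<omega>}"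
  \<comment> \<open>For small \<open>n\<close> there are no windows, and \<open>mesh n\<close> is a division by zero.\<close>
  define A where "A n = (if 0 < n \<and> 0 < half_windows n then near_origin a b (\<rho> + 1) n \<union> ?many n else {})" for n
  have many: "?many n \<in> events" for n
    using measurable_sets[OF point_count_measurable[of "{0..<real n}"], of "{n ^ 2<..}"]
    by (simp add: vimage_def Int_def conj_commute)
  have near: "near_origin a b (\<rho> + 1) n \<in> events" if "0 < n" "0 < half_windows n" for n
    using near_origin_prob_le_explicit(1)[OF ab _ that, of "\<rho> + 1" 1] \<rho> by simp
  have ev: "A n \<in> events" for n unfolding A_def using many near by auto
  have sum1: "summable (\<lambda>n. real n powr (- 1 - \<alpha>))" using alpha by (simp add: summable_real_powr_iff)
  have sum2: "summable (\<lambda>n. exp (- (\<beta> * real n powr (1 - \<alpha>))))"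
  proof (rule summable_comparison_test_bigo)
    show "summable (\<lambda>n. norm (real n powr - 2))" by (simp add: summable_real_powr_iff)
    show "(\<lambda>n. exp (- (\<beta> * real n powr (1 - \<alpha>)))) \<in> O(\<lambda>n. real n powr - 2)" using alpha \<beta> by real_asymp
  qed
  let ?g = "\<lambda>n. C * real n powr (- 1 - \<alpha>) + D * exp (- (\<beta> * real n powr (1 - \<alpha>))) + real n powr (- 1 - \<alpha>) / (1 - \<alpha>)"
  have "eventually (\<lambda>n. norm (prob (A n)) \<le> ?g n) sequentially"
    using eventually_half_windows_pos eventually_gt_at_top[of "0::nat"]
  proof eventually_elim
    case (elim n)
    then have "prob (A n) \<le> prob (near_origin a b (\<rho> + 1) n) + prob (?many n)"
      using measure_Un_le[OF near many, of n n] by (simp add: A_def)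
    also have "\<dots> \<le> ?g n" using bound[of n] prob_many_points_le[of n] elim by (intro add_mono) auto
    finally show ?case by simp
  qed
  moreover have "summable ?g" using sum1 sum2 by (intro summable_add summable_mult summable_divide)
  ultimately have "summable (\<lambda>n. prob (A n))" by (rule summable_comparison_test_ev)
  then have "AE \<omega> in M. eventually (\<lambda>n. \<omega> \<in> space M - A n) sequentially"
    by (intro borel_cantelli_AE1 ev) (auto simp: less_top[symmetric])
  then show ?thesis
    using AE_jump_times AE_direction_component_le_1
  proof eventually_elim
    case (elim \<omega>)
    let ?Z = "walk (\<lambda>k. \<tau> k \<omega>) (\<lambda>k. f k \<omega>)"
    from elim(1) eventually_half_windows_pos eventually_gt_at_top[of "0::nat"]
    show ?case
    proof eventually_elim
      case (elim n)
      note n = elim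
      let ?L = "2 * half_windows n" and ?B = "2 * n ^ 3" and ?\<delta> = "mesh n"
      have \<delta>: "0 < ?\<delta>" "real (?L * ?B) * ?\<delta> = real n" using n by (auto simp: mesh_def)
      have few: "point_count \<tau> {0..<real n} \<omega> \<le> n ^ 2" and out: "\<omega> \<notin> near_origin a b (\<rho> + 1) n"
        using n by (auto simp: A_def not_less)
      have approx: "\<bar>?Z (real n) $ d - ?\<delta> * grid_sum ?L ?B (window_counts ?\<delta> ?L ?B \<omega>) (\<lambda>k. f k \<omega> $ d)\<bar> \<le> 1" for d
      proof -
        have "\<bar>?Z (real n) $ d - ?\<delta> * grid_sum ?L ?B (window_counts ?\<delta> ?L ?B \<omega>) (\<lambda>k. f k \<omega> $ d)\<bar>
           \<le> 2 * ?\<delta> * real (point_count \<tau> {0..<real n} \<omega>)"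
          using walk_grid_sum_approx[of \<omega> ?\<delta> ?L ?B d] \<open>jump_times (\<lambda>k. \<tau> k \<omega>)\<close> \<open>\<forall>k a. \<bar>f k \<omega> $ a\<bar> \<le> 1\<close> \<delta>
          by (simp only: simp_thms)
        also have "\<dots> \<le> 2 * ?\<delta> * real (n ^ 2)" using few \<delta> by (intro mult_left_mono of_nat_mono) auto
        also have "\<dots> = 1 / (2 * real (half_windows n))"
          using n by (simp add: mesh_def power2_eq_square power3_eq_cube)
        also have "\<dots> \<le> 1" using n by simp
        finally show ?thesis .
      qed
      show ?case
      proof (rule ccontr)
        assume "\<not> ?case"
        then have "\<bar>?Z (real n) $ a\<bar> \<le> \<rho>" "\<bar>?Z (real n) $ b\<bar> \<le> \<rho>" by auto
        then have "grid_box ?\<delta> ?L ?B (\<rho> + 1) a b (window_counts ?\<delta> ?L ?B \<omega>) (\<lambda>k. f k \<omega>)"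
          using approx[of a] approx[of b] unfolding grid_box_def by linarith
        then show False using out n(1) by (auto simp: near_origin_def)
      qed
    qed
  qed
qed

text \<open>
  Between a visit to a box and the preceding integer time the walk covers a distance of at most
  \<open>1\<close> in each coordinate.
\<close>

lemma AE_transient:
  assumes d: "CARD('d) \<ge> 2"
  shows "AE \<omega> in M. transient_path (walk (\<lambda>k. \<tau> k \<omega>) (\<lambda>k. f k \<omega>))"
proof -
  obtain a b :: 'd where ab: "a \<noteq> b"
    using d by (metis (mono_tags, lifting) UNIV_I card_2_iff' ex_card)
  have "AE \<omega> in M. \<forall>R::nat. eventually (\<lambda>n. 
    real R < \<bar>walk (\<lambda>k. \<tau> k \<omega>) (\<lambda>k. f k \<omega>) (real n) $ a\<bar> \<or> real R < \<bar>walk (\<lambda>k. \<tau> k \<omega>) (\<lambda>k. f k \<omega>) (real n) $ b\<bar>) sequentially"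
    unfolding AE_all_countable using AE_eventually_walk_outside[OF ab] by simp
  then show ?thesis
    using AE_jump_times AE_direction_component_le_1
  proof eventually_elim
    case (elim \<omega>)
    let ?Z = "walk (\<lambda>k. \<tau> k \<omega>) (\<lambda>k. f k \<omega>)"
    interpret jump_times "\<lambda>k. \<tau> k \<omega>" by (rule elim(2))
    show ?case
      unfolding transient_path_def recurrent_path_def
    proof (intro allI impI notI, elim exE conjE)
      fix \<rho> :: real and u :: "nat \<Rightarrow> real"
      assume u: "\<forall>i. 0 \<le> u i" "filterlim u at_top sequentially" "\<forall>i j. ?Z (u i) $ j \<in> {-\<rho>..\<rho>}"
      define R where "R = nat \<lceil>\<rho> + 1\<rceil>"
      have R: "\<rho> + 1 \<le> real R" unfolding R_def by linarith
      from elim(1) obtain n0 where n0: "\<And>n. n0 \<le> n \<Longrightarrow> real R < \<bar>?Z (real n) $ a\<bar> \<or> real R < \<bar>?Z (real n) $ b\<bar>"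
        unfolding eventually_sequentially by blast
      obtain i where i: "real (Suc n0) \<le> u i"
        using u(2) unfolding filterlim_at_top eventually_sequentially by blast
      define n where "n = nat \<lfloor>u i\<rfloor>"
      have n: "real n \<le> u i" "u i - real n \<le> 1" "n0 \<le> n" unfolding n_def using i by linarith+
      have "\<bar>?Z (real n) $ c\<bar> \<le> real R" for c
      proof -
        have "\<bar>?Z (u i) $ c - ?Z (real n) $ c\<bar> \<le> u i - real n"
          by (rule walk_component_lipschitz) (use n elim(3) in auto)
        moreover have "\<bar>?Z (u i) $ c\<bar> \<le> \<rho>" using u(3)[rule_format, of i c] by (simp add: abs_le_iff)
        ultimately show ?thesis using n R by linarith
      qed
      then show False using n0[OF n(3)] by (meson not_less)
    qed
  qed
qed

end

theorem theorem2:
  fixes M :: "'a measure"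
    and \<alpha> :: real
    and \<tau> :: "nat \<Rightarrow> 'a \<Rightarrow> real"
    and f :: "nat \<Rightarrow> 'a \<Rightarrow> real ^ 'd"
  assumes "CARD('d) \<ge> 2"
    and "0 < \<alpha>" and "\<alpha> < 1"
    and "orthogonal_walk M (\<lambda>t. t powr - \<alpha>) \<tau> f"
  shows "AE \<omega> in M. transient_path (walk (\<lambda>k. \<tau> k \<omega>) (\<lambda>k. f k \<omega>))"
proof -
  interpret power_rate_walk M \<alpha> \<tau> f
    using assms by (intro power_rate_walk.intro power_rate_walk_axioms.intro)
  show ?thesis by (rule AE_transient[OF assms(1)])
qed

end
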